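(* Let $A$ be a C$^*$-algebra and let $T:A\to A^{**}$ be a bounded linear operator. Then the following statements are equivalent: (a) $T$ is l-$^*$-anti-derivable at zero, i.e. for all $a,b\in A$, $a^*b=0$ in $A$ implies $T(b)a^*+bT(a)^*=0$ in $A^{**}$; (b) There exist a $^*$-derivation $d:A\to A^{**}$ and an element $\eta\in A^{**}$ satisfying the following properties: (i) $d([a,b])+[a,b]\eta^*+\eta[a,b]=0$ for all $a,b\in A$; (ii) $T(ab)=aT(b)+T(a)b-a\eta b$ and $T(a)=d(a)+\eta a$ for all $a,b\in A$.
   Context: C$^*$-algebras are complex and need not be unital. $A^{**}$ is the bidual of $A$ with its product and involution as the enveloping von Neumann algebra, and $A$ is identified with its canonical image in $A^{**}$. A $^*$-derivation $d:A\to A^{**}$ is a linear map with $d(ab)=d(a)b+a\,d(b)$ and $d(a^* )=d(a)^*$ for all $a,b\in A$. The commutator is $[a,b]=ab-ba$. *)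

theory Defs
  imports "HOL-Analysis.Analysis"
begin

section \<open>Complex normed spaces and C*-algebras\<close>

text \<open>A complex scaling is added to the library's real normed spaces; the fourth axiom ties it
  to the real scaling.\<close>

class complex_normed_vector = real_normed_vector +
  fixes scaleC :: "complex \<Rightarrow> 'a \<Rightarrow> 'a"  (infixr \<open>*\<^sub>C\<close> 75)
  assumes scaleC_add_right: "c *\<^sub>C (x + y) = c *\<^sub>C x + c *\<^sub>C y"
    and scaleC_add_left: "(b + c) *\<^sub>C x = b *\<^sub>C x + c *\<^sub>C x"
    and scaleC_scaleC: "b *\<^sub>C c *\<^sub>C x = (b * c) *\<^sub>C x"
    and scaleR_scaleC: "scaleR r x = complex_of_real r *\<^sub>C x"
    and norm_scaleC: "norm (c *\<^sub>C x) = cmod c * norm x"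

text \<open>No unit is required, and the zero algebra is included.\<close>

class cstar_algebra = complex_normed_vector + real_normed_algebra + complete_space +
  fixes star :: "'a \<Rightarrow> 'a"  (\<open>_\<^sup>\<star>\<close> [1000] 999)
  assumes mult_scaleC_left: "(c *\<^sub>C x) * y = c *\<^sub>C (x * y)"
    and mult_scaleC_right: "x * (c *\<^sub>C y) = c *\<^sub>C (x * y)"
    and star_star: "(x\<^sup>\<star>)\<^sup>\<star> = x"
    and star_add: "(x + y)\<^sup>\<star> = x\<^sup>\<star> + y\<^sup>\<star>"
    and star_scaleC: "(c *\<^sub>C x)\<^sup>\<star> = cnj c *\<^sub>C x\<^sup>\<star>"
    and star_mult: "(x * y)\<^sup>\<star> = y\<^sup>\<star> * x\<^sup>\<star>"
    and cstar_identity: "norm (x\<^sup>\<star> * x) = (norm x)\<^sup>2"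

instantiation complex :: complex_normed_vector
begin

definition scaleC_complex :: "complex \<Rightarrow> complex \<Rightarrow> complex" where
  "scaleC_complex c x = c * x"

instance
  by standard (auto simp: scaleC_complex_def algebra_simps norm_mult scaleR_conv_of_real)

end

instantiation complex :: cstar_algebra
begin

definition star_complex :: "complex \<Rightarrow> complex" where
  "star_complex x = cnj x"

instance
  by standard (auto simp: scaleC_complex_def star_complex_def norm_mult power2_eq_square)

end

lemma vector_space_scaleC:
  "vector_space ((*\<^sub>C) :: complex \<Rightarrow> 'a \<Rightarrow> 'a::complex_normed_vector)"
proof
  fix x :: 'a
  show "1 *\<^sub>C x = x"
    using scaleR_scaleC[of 1 x] by simp
qed (simp_all add: scaleC_add_right scaleC_add_left scaleC_scaleC)

abbreviation clinear :: "('a::complex_normed_vector \<Rightarrow> 'b::complex_normed_vector) \<Rightarrow> bool" where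
  "clinear \<equiv> Vector_Spaces.linear (*\<^sub>C) (*\<^sub>C)"

definition bounded_clinear ::
    "('a::complex_normed_vector \<Rightarrow> 'b::complex_normed_vector) \<Rightarrow> bool" where
  "bounded_clinear f \<longleftrightarrow> clinear f \<and> (\<exists>K. \<forall>x. norm (f x) \<le> K * norm x)"

lemma clinear_iff:
  "clinear f \<longleftrightarrow> (\<forall>x y. f (x + y) = f x + f y) \<and> (\<forall>c x. f (c *\<^sub>C x) = c *\<^sub>C f x)"
  by (auto simp: Vector_Spaces.linear_def module_hom_def module_hom_axioms_def
      vector_space_scaleC module_iff_vector_space)

lemma bounded_clinear_iff:
  "bounded_clinear f \<longleftrightarrow> bounded_linear f \<and> (\<forall>c x. f (c *\<^sub>C x) = c *\<^sub>C f x)"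
  by (auto simp: bounded_clinear_def clinear_iff bounded_linear_def bounded_linear_axioms_def
      linear_iff scaleR_scaleC mult.commute)

section \<open>The dual space\<close>

typedef (overloaded) 'a cdual = "{f :: 'a::complex_normed_vector \<Rightarrow> complex. bounded_clinear f}"
  morphisms apply_dual Abs_dual
  by (rule exI[of _ "\<lambda>_. 0"]) (simp add: bounded_clinear_iff scaleC_complex_def)

setup_lifting type_definition_cdual

lemma apply_dual_bounded_clinear: "bounded_clinear (apply_dual f)"
  using apply_dual by simp

lemma apply_dual_bounded_linear: "bounded_linear (apply_dual f)"
  using apply_dual_bounded_clinear bounded_clinear_iff by blast

lemma apply_dual_add [simp]: "apply_dual f (x + y) = apply_dual f x + apply_dual f y"
  using apply_dual_bounded_clinear[of f] by (simp add: bounded_clinear_def clinear_iff)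

lemma apply_dual_scaleC [simp]: "apply_dual f (c *\<^sub>C x) = c * apply_dual f x"
  using apply_dual_bounded_clinear[of f] by (simp add: bounded_clinear_iff scaleC_complex_def)

lemma onorm_scaleC:
  assumes "bounded_linear f"
  shows "onorm (\<lambda>x. c * f x) = cmod c * onorm (f :: 'a::real_normed_vector \<Rightarrow> complex)"
proof -
  have le: "onorm (\<lambda>x. c * g x) \<le> cmod c * onorm g"
    if "bounded_linear g" for c and g :: "'a \<Rightarrow> complex"
    using onorm_bound[of "cmod c * onorm g" "\<lambda>x. c * g x"] onorm[OF that] onorm_pos_le[OF that]
    by (simp add: norm_mult mult.assoc mult_left_mono)
  show ?thesis
  proof (cases "c = 0")
    case False
    have "onorm f = onorm (\<lambda>x. inverse c * (c * f x))"
      using False by (simp flip: mult.assoc)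
    also have "\<dots> \<le> cmod (inverse c) * onorm (\<lambda>x. c * f x)"
      by (rule le) (rule bounded_linear_const_mult[OF assms])
    finally have "cmod c * onorm f \<le> onorm (\<lambda>x. c * f x)"
      using False by (simp add: norm_inverse norm_divide field_simps)
    with le[OF assms, of c] show ?thesis by simp
  qed (simp add: onorm_zero)
qed

instantiation cdual :: (complex_normed_vector) complex_normed_vector
begin

lift_definition norm_cdual :: "'a cdual \<Rightarrow> real" is onorm .

lift_definition zero_cdual :: "'a cdual" is "\<lambda>_. 0"
  by (simp add: bounded_clinear_iff scaleC_complex_def)

lift_definition plus_cdual :: "'a cdual \<Rightarrow> 'a cdual \<Rightarrow> 'a cdual" is "\<lambda>f g x. f x + g x"
  by (auto simp: bounded_clinear_iff scaleC_complex_def algebra_simps intro: bounded_linear_add)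

lift_definition minus_cdual :: "'a cdual \<Rightarrow> 'a cdual \<Rightarrow> 'a cdual" is "\<lambda>f g x. f x - g x"
  by (auto simp: bounded_clinear_iff scaleC_complex_def algebra_simps intro: bounded_linear_sub)

lift_definition uminus_cdual :: "'a cdual \<Rightarrow> 'a cdual" is "\<lambda>f x. - f x"
  by (auto simp: bounded_clinear_iff scaleC_complex_def intro: bounded_linear_minus)

lift_definition scaleC_cdual :: "complex \<Rightarrow> 'a cdual \<Rightarrow> 'a cdual" is "\<lambda>c f x. c * f x"
  by (auto simp: bounded_clinear_iff scaleC_complex_def intro: bounded_linear_const_mult)

definition scaleR_cdual :: "real \<Rightarrow> 'a cdual \<Rightarrow> 'a cdual" where
  "scaleR_cdual r f = complex_of_real r *\<^sub>C f"

definition dist_cdual :: "'a cdual \<Rightarrow> 'a cdual \<Rightarrow> real" where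
  "dist_cdual f g = norm (f - g)"

definition sgn_cdual :: "'a cdual \<Rightarrow> 'a cdual" where
  "sgn_cdual f = scaleR (inverse (norm f)) f"

definition uniformity_cdual :: "('a cdual \<times> 'a cdual) filter" where
  "uniformity_cdual = (INF e\<in>{0 <..}. principal {(f, g). dist f g < e})"

definition open_cdual :: "'a cdual set \<Rightarrow> bool" where
  "open_cdual S = (\<forall>f\<in>S. \<forall>\<^sub>F (f', g) in uniformity. f' = f \<longrightarrow> g \<in> S)"

instance
proof
  fix f g h :: "'a cdual" and b c :: complex and r s :: real
  show "f + g + h = f + (g + h)" by transfer (simp add: add.assoc)
  show "f + g = g + f" by transfer (simp add: add.commute)
  show "0 + f = f" by transfer simp
  show "- f + f = 0" by transfer simp
  show "f - g = f + - g" by transfer simp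
  show A: "c *\<^sub>C (f + g) = c *\<^sub>C f + c *\<^sub>C g" by transfer (simp add: algebra_simps)
  show B: "(b + c) *\<^sub>C f = b *\<^sub>C f + c *\<^sub>C f" by transfer (simp add: algebra_simps)
  show C: "b *\<^sub>C c *\<^sub>C f = (b * c) *\<^sub>C f" by transfer (simp add: algebra_simps)
  show "scaleR r f = complex_of_real r *\<^sub>C f" by (simp add: scaleR_cdual_def)
  show D: "norm (c *\<^sub>C f) = cmod c * norm f"
    by transfer (simp add: onorm_scaleC bounded_clinear_iff)
  show "scaleR r (f + g) = scaleR r f + scaleR r g"
    unfolding scaleR_cdual_def by transfer (simp add: algebra_simps)
  show "scaleR (r + s) f = scaleR r f + scaleR s f"
    unfolding scaleR_cdual_def by transfer (simp add: algebra_simps)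
  show "scaleR r (scaleR s f) = scaleR (r * s) f"
    unfolding scaleR_cdual_def by transfer (simp add: algebra_simps)
  show "scaleR 1 f = f"
    unfolding scaleR_cdual_def by transfer simp
  show "norm (scaleR r f) = \<bar>r\<bar> * norm f"
    unfolding scaleR_cdual_def
    by transfer (simp add: onorm_scaleC bounded_clinear_iff)
  show "norm f = 0 \<longleftrightarrow> f = 0"
    by transfer (auto simp: onorm_eq_0 bounded_clinear_iff fun_eq_iff)
  show "norm (f + g) \<le> norm f + norm g"
    by transfer (simp add: onorm_triangle bounded_clinear_iff)
qed (simp_all add: dist_cdual_def sgn_cdual_def uniformity_cdual_def open_cdual_def)

end

lemma norm_apply_dual: "cmod (apply_dual f x) \<le> norm f * norm x"
  by transfer (simp add: onorm bounded_clinear_iff)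

lemma norm_cdual_bound:
  assumes "0 \<le> K" "\<And>x. cmod (apply_dual f x) \<le> K * norm x"
  shows "norm f \<le> K"
  using assms by transfer (simp add: onorm_bound)

lemma apply_dual_plus [simp]: "apply_dual (f + g) x = apply_dual f x + apply_dual g x"
  by transfer simp

lemma apply_dual_scaleC_left [simp]: "apply_dual (c *\<^sub>C f) x = c * apply_dual f x"
  by transfer simp

section \<open>The bidual of a C*-algebra\<close>

type_synonym 'a bidual = "'a cdual cdual"

lift_definition to_bidual :: "'a::complex_normed_vector \<Rightarrow> 'a bidual"  (\<open>\<iota>\<close>)
  is "\<lambda>a f. apply_dual f a"
proof -
  fix a :: 'a
  show "bounded_clinear (\<lambda>f. apply_dual f a)"
    unfolding bounded_clinear_def clinear_iff
    using norm_apply_dual[of _ a]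
    by (auto simp: scaleC_complex_def mult.commute intro!: exI[of _ "norm a"])
qed

text \<open>The product of the enveloping von Neumann algebra, transported to the bidual by the
  Sherman--Takeda theorem, is the (first) Arens product: with \<open>(f \<cdot> a) b = f (a b)\<close> and
  \<open>(n \<cdot> f) a = n (f \<cdot> a)\<close> one puts \<open>(m \<odot> n) f = m (n \<cdot> f)\<close>. C*-algebras are Arens
  regular, so the other Arens product is the same.\<close>

lift_definition dual_mult :: "'a::cstar_algebra cdual \<Rightarrow> 'a \<Rightarrow> 'a cdual"
  is "\<lambda>f a b. f (a * b)"
  by (auto simp: bounded_clinear_iff mult_scaleC_right
      intro: bounded_linear_compose[OF _ bounded_linear_mult_right])

lemma apply_dual_mult [simp]: "apply_dual (dual_mult f a) b = apply_dual f (a * b)"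
  by transfer simp

lemma norm_dual_mult: "norm (dual_mult f a) \<le> norm f * norm a"
proof (rule norm_cdual_bound)
  fix b
  have "cmod (apply_dual f (a * b)) \<le> norm f * norm (a * b)"
    by (rule norm_apply_dual)
  also have "\<dots> \<le> norm f * (norm a * norm b)"
    by (intro mult_left_mono norm_mult_ineq norm_ge_zero)
  finally show "cmod (apply_dual (dual_mult f a) b) \<le> norm f * norm a * norm b"
    by (simp add: mult.assoc)
qed simp

lemma dual_mult_add_right: "dual_mult f (a + b) = dual_mult f a + dual_mult f b"
  by (simp add: apply_dual_inject[symmetric] fun_eq_iff distrib_right)

lemma dual_mult_add_left: "dual_mult (f + g) a = dual_mult f a + dual_mult g a"
  by (simp add: apply_dual_inject[symmetric] fun_eq_iff)

lemma dual_mult_scaleC_right: "dual_mult f (c *\<^sub>C a) = c *\<^sub>C dual_mult f a"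
  by (simp add: apply_dual_inject[symmetric] fun_eq_iff mult_scaleC_left)

lemma dual_mult_scaleC_left: "dual_mult (c *\<^sub>C f) a = c *\<^sub>C dual_mult f a"
  by (simp add: apply_dual_inject[symmetric] fun_eq_iff)

lemma norm_apply_dual_mult:
  "cmod (apply_dual n (dual_mult f a)) \<le> norm n * norm f * norm a"
  using norm_apply_dual[of n "dual_mult f a"]
    mult_left_mono[OF norm_dual_mult[of f a] norm_ge_zero[of n]]
  by (simp add: mult.assoc)

lift_definition bidual_act :: "'a::cstar_algebra bidual \<Rightarrow> 'a cdual \<Rightarrow> 'a cdual"
  is "\<lambda>n f a. n (dual_mult f a)"
proof -
  fix n :: "'a cdual \<Rightarrow> complex" and f :: "'a cdual"
  assume "bounded_clinear n"
  then obtain n' where "n = apply_dual n'"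
    using Abs_dual_inverse[of n] by (metis mem_Collect_eq)
  then show "bounded_clinear (\<lambda>a. n (dual_mult f a))"
    unfolding bounded_clinear_def clinear_iff
    using norm_apply_dual_mult[of n' f]
    by (auto simp: scaleC_complex_def dual_mult_add_right dual_mult_scaleC_right
        intro!: exI[of _ "norm n' * norm f"])
qed

lemma apply_bidual_act [simp]: "apply_dual (bidual_act n f) a = apply_dual n (dual_mult f a)"
  by transfer simp

lemma norm_bidual_act: "norm (bidual_act n f) \<le> norm n * norm f"
  by (rule norm_cdual_bound) (simp_all add: norm_apply_dual_mult)

lift_definition bidual_mult :: "'a::cstar_algebra bidual \<Rightarrow> 'a bidual \<Rightarrow> 'a bidual"
    (infixl \<open>\<odot>\<close> 70)
  is "\<lambda>m n f. m (bidual_act n f)"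
proof -
  fix m :: "'a cdual \<Rightarrow> complex" and n :: "'a bidual"
  assume "bounded_clinear m"
  then obtain m' where m: "m = apply_dual m'"
    using Abs_dual_inverse[of m] by (metis mem_Collect_eq)
  have add: "bidual_act n (f + g) = bidual_act n f + bidual_act n g" for f g
    by (simp add: apply_dual_inject[symmetric] fun_eq_iff dual_mult_add_left)
  have scale: "bidual_act n (c *\<^sub>C f) = c *\<^sub>C bidual_act n f" for c f
    by (simp add: apply_dual_inject[symmetric] fun_eq_iff dual_mult_scaleC_left)
  have "cmod (apply_dual m' (bidual_act n f)) \<le> norm m' * norm n * norm f" for f
    using norm_apply_dual[of m' "bidual_act n f"]
      mult_left_mono[OF norm_bidual_act[of n f] norm_ge_zero[of m']]
    by (simp add: mult.assoc)
  then show "bounded_clinear (\<lambda>f. m (bidual_act n f))"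
    unfolding bounded_clinear_def clinear_iff
    by (auto simp: m scaleC_complex_def add scale intro!: exI[of _ "norm m' * norm n"])
qed

lemma apply_bidual_mult: "apply_dual (m \<odot> n) f = apply_dual m (bidual_act n f)"
  by transfer simp

text \<open>The involution is the weak*-continuous extension of the one of the algebra:
  \<open>m* f = cnj (m f*)\<close> where \<open>f* a = cnj (f a*)\<close>.\<close>

lemma norm_star: "norm (x\<^sup>\<star>) = norm (x :: 'a::cstar_algebra)"
proof -
  have le: "norm y \<le> norm (y\<^sup>\<star>)" for y :: 'a
  proof (cases "norm y = 0")
    case False
    have "norm y * norm y \<le> norm (y\<^sup>\<star>) * norm y"
      using norm_mult_ineq[of "y\<^sup>\<star>" y] by (simp add: cstar_identity power2_eq_square)
    with False show ?thesis by (simp add: mult_le_cancel_right)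
  qed simp
  from le[of x] le[of "x\<^sup>\<star>"] show ?thesis by (simp add: star_star)
qed

lift_definition dual_star :: "'a::cstar_algebra cdual \<Rightarrow> 'a cdual"
  is "\<lambda>f a. cnj (f (a\<^sup>\<star>))"
  unfolding bounded_clinear_def clinear_iff
  by (auto simp: scaleC_complex_def star_add star_scaleC) (metis norm_star)

lemma apply_dual_star [simp]: "apply_dual (dual_star f) a = cnj (apply_dual f (a\<^sup>\<star>))"
  by transfer simp

lemma norm_dual_star: "norm (dual_star f) \<le> norm f"
  by (rule norm_cdual_bound) (simp_all, metis norm_apply_dual norm_star)

lift_definition bidual_star :: "'a::cstar_algebra bidual \<Rightarrow> 'a bidual"  (\<open>_\<^sup>\<bullet>\<close> [1000] 999)
  is "\<lambda>m f. cnj (m (dual_star f))"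
proof -
  fix m :: "'a cdual \<Rightarrow> complex"
  assume "bounded_clinear m"
  then obtain m' where m: "m = apply_dual m'"
    using Abs_dual_inverse[of m] by (metis mem_Collect_eq)
  have add: "dual_star (f + g) = dual_star f + dual_star g" for f g :: "'a cdual"
    by (simp add: apply_dual_inject[symmetric] fun_eq_iff)
  have scale: "dual_star (c *\<^sub>C f) = cnj c *\<^sub>C dual_star f" for c and f :: "'a cdual"
    by (simp add: apply_dual_inject[symmetric] fun_eq_iff)
  have "cmod (apply_dual m' (dual_star f)) \<le> norm m' * norm f" for f
    using norm_apply_dual[of m' "dual_star f"]
      mult_left_mono[OF norm_dual_star[of f] norm_ge_zero[of m']] by linarith
  then show "bounded_clinear (\<lambda>f. cnj (m (dual_star f)))"
    unfolding bounded_clinear_def clinear_iff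
    by (auto simp: m scaleC_complex_def add scale intro!: exI[of _ "norm m'"])
qed

lemma apply_bidual_star: "apply_dual (m\<^sup>\<bullet>) f = cnj (apply_dual m (dual_star f))"
  by transfer simp

lemma apply_to_bidual [simp]: "apply_dual (\<iota> a) f = apply_dual f a"
  by transfer simp

lemma to_bidual_mult: "\<iota> (a * b) = \<iota> a \<odot> \<iota> b"
  by (simp add: apply_dual_inject[symmetric] fun_eq_iff apply_bidual_mult)

lemma to_bidual_star: "\<iota> (a\<^sup>\<star>) = (\<iota> a)\<^sup>\<bullet>"
  by (simp add: apply_dual_inject[symmetric] fun_eq_iff apply_bidual_star)

lemma bidual_star_star: "(m\<^sup>\<bullet>)\<^sup>\<bullet> = m"
proof -
  have star2: "dual_star (dual_star f) = f" for f :: "'a cdual"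
    by (simp add: apply_dual_inject[symmetric] fun_eq_iff star_star)
  then show ?thesis
    by (simp add: apply_dual_inject[symmetric, of _ m] fun_eq_iff apply_bidual_star star2)
qed

section \<open>Derivations and anti-derivable maps\<close>

definition commutator :: "'a::cstar_algebra \<Rightarrow> 'a \<Rightarrow> 'a" where
  "commutator a b = a * b - b * a"

definition star_derivation :: "('a::cstar_algebra \<Rightarrow> 'a bidual) \<Rightarrow> bool" where
  "star_derivation d \<longleftrightarrow> clinear d
     \<and> (\<forall>a b. d (a * b) = d a \<odot> \<iota> b + \<iota> a \<odot> d b)
     \<and> (\<forall>a. d (a\<^sup>\<star>) = (d a)\<^sup>\<bullet>)"

definition l_star_anti_derivable_at_zero :: "('a::cstar_algebra \<Rightarrow> 'a bidual) \<Rightarrow> bool" where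
  "l_star_anti_derivable_at_zero T \<longleftrightarrow>
     (\<forall>a b. a\<^sup>\<star> * b = 0 \<longrightarrow> T b \<odot> \<iota> (a\<^sup>\<star>) + \<iota> b \<odot> (T a)\<^sup>\<bullet> = 0)"

end

theory Submission
  imports Defs "HOL-Complex_Analysis.Cauchy_Integral_Formula"
begin

text \<open>Suppose that \<open>T\<close> is l-*-anti-derivable at zero and put \<open>B a b = T b \<odot> a\<^sup>* + b \<odot> (T a)\<^sup>*\<close>,
  a bounded sesquilinear map that vanishes whenever \<open>a\<^sup>* b = 0\<close>. Every such map is balanced,
  \<open>B (c a) b = B a (c\<^sup>* b)\<close> (theorem \<open>orthogonal_form_balanced\<close>). By linearity \<open>c\<close> may be a
  self-adjoint \<open>h\<close>, and then only the map \<open>(f, g) \<mapsto> B (f(h) a) (g(h) b)\<close> on continuous functions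
  matters. It vanishes if \<open>f g = 0\<close>, so a factor that takes only the values 0 and 1 on the support
  of \<open>f g\<close> can be moved from \<open>f\<close> to \<open>g\<close>; if \<open>f\<close> vanishes on a suitable periodic set of gaps, then
  staircases that rise in the gaps are sums of such factors and come uniformly close to the identity
  function (\<open>orthogonal_form_id\<close>). The continuous functional calculus rests
  on the bound of \<open>p(h)\<close>, for \<open>\<parallel>h\<parallel> < 1\<close>, by the supremum of \<open>\<bar>p\<bar>\<close> on \<open>[-1, 1]\<close>
  (\<open>norm_poly_mult_le\<close>), which is derived from the unitary \<open>h + i (1 - h\<^sup>2)\<^sup>1\<^sup>/\<^sup>2\<close> without spectral theory.

  In the balanced identity one lets \<open>a\<close> or \<open>b\<close> run through an approximate unit. With \<open>\<eta>\<close> the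
  weak* limit of \<open>T\<close> along it, \<open>d a = T a - \<eta> \<odot> a\<close> commutes with the involutions and satisfies
  \<open>d (c b) = d b \<odot> c + b \<odot> d c - \<eta> \<odot> [c, b] - [c, b] \<odot> \<eta>\<^sup>*\<close>. The limits exist and the unit acts
  trivially on the bidual because \<open>f (e b) \<rightarrow> f b\<close> uniformly on the unit ball for every functional
  \<open>f\<close> (\<open>tendsto_dual_mult\<close>).

  It remains to see that \<open>d\<close> is a derivation. Expanding \<open>d (x c b)\<close> in two ways shows that \<open>d\<close>
  agrees with the inner derivation \<open>a \<mapsto> a \<eta> - \<eta> a\<close> in front of a commutator and with
  \<open>a \<mapsto> \<eta>\<^sup>* a - a \<eta>\<^sup>*\<close> behind one (\<open>left_defect_any_commutator\<close>, \<open>right_defect_any_commutator\<close>).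
  A commutator \<open>u\<close> is a limit of products \<open>u w u\<close>, on which these two formulas determine \<open>d\<close>; the
  outcome is the commutator condition \<open>d u + u \<odot> \<eta>\<^sup>* + \<eta> \<odot> u = 0\<close>, and with it the rule for \<open>d (c b)\<close> becomes the Leibniz
  rule. Conversely, \<open>a\<^sup>* b = 0\<close> makes \<open>b a\<^sup>*\<close> equal to the commutator \<open>[b, a\<^sup>*]\<close>, and \<open>B a b\<close> is
  the left side of the commutator condition at \<open>b a\<^sup>*\<close> if \<open>T a = d a + \<eta> \<odot> a\<close>.\<close>

section \<open>The bidual as a normed bimodule\<close>

lemma cdual_eqI: "(\<And>x. apply_dual f x = apply_dual g x) \<Longrightarrow> f = g"
  by (simp add: apply_dual_inject[symmetric] fun_eq_iff)

lemma apply_dual_zero_left [simp]: "apply_dual 0 x = 0"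
  by transfer simp

lemma apply_dual_diff_left [simp]: "apply_dual (f - g) x = apply_dual f x - apply_dual g x"
  by transfer simp

lemma apply_dual_uminus_left [simp]: "apply_dual (- f) x = - apply_dual f x"
  by transfer simp

lemma apply_dual_zero [simp]: "apply_dual f 0 = 0"
  and apply_dual_diff [simp]: "apply_dual f (x - y) = apply_dual f x - apply_dual f y"
  and apply_dual_uminus [simp]: "apply_dual f (- x) = - apply_dual f x"
  using apply_dual_bounded_linear[of f]
  by (auto simp: linear_0 linear_diff linear_neg bounded_linear.linear)

lemma scaleC_one [simp]: "1 *\<^sub>C (x :: 'a::complex_normed_vector) = x"
  by (metis scaleR_one scaleR_scaleC of_real_1)

lemma scaleC_zero_right [simp]: "c *\<^sub>C (0 :: 'a::complex_normed_vector) = 0"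
  by (metis norm_scaleC norm_zero mult_zero_right norm_eq_zero)

lemma scaleC_minus_right: "c *\<^sub>C (- x) = - (c *\<^sub>C x :: 'a::complex_normed_vector)"
  by (metis add.right_inverse add_eq_0_iff scaleC_add_right scaleC_zero_right)

lemma scaleC_diff_right: "c *\<^sub>C (x - y) = c *\<^sub>C x - (c *\<^sub>C y :: 'a::complex_normed_vector)"
  by (metis diff_conv_add_uminus scaleC_add_right scaleC_minus_right)

lemma scaleC_minus_one [simp]: "(- 1) *\<^sub>C x = - (x :: 'a::complex_normed_vector)"
  using scaleR_scaleC[of "-1" x] by simp

lemma scaleC_minus_left: "(- c) *\<^sub>C x = - (c *\<^sub>C x :: 'a::complex_normed_vector)"
  using scaleC_scaleC[of "-1" c x] by simp

lemma scaleC_zero_left [simp]: "0 *\<^sub>C x = (0 :: 'a::complex_normed_vector)"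
  using scaleR_scaleC[of 0 x] by simp

lemma to_bidual_add: "\<iota> (a + b) = \<iota> a + \<iota> b"
  and to_bidual_diff: "\<iota> (a - b) = \<iota> a - \<iota> b"
  and to_bidual_minus: "\<iota> (- a) = - \<iota> a"
  and to_bidual_zero: "\<iota> 0 = 0"
  and to_bidual_scaleC: "\<iota> (c *\<^sub>C a) = c *\<^sub>C \<iota> a"
  by (rule cdual_eqI; simp)+

lemma bidual_act_simps:
  "bidual_act n (f + g) = bidual_act n f + bidual_act n g"
  "bidual_act n (c *\<^sub>C f) = c *\<^sub>C bidual_act n f"
  "bidual_act (m + n) f = bidual_act m f + bidual_act n f"
  "bidual_act (m - n) f = bidual_act m f - bidual_act n f"
  "bidual_act (- n) f = - bidual_act n f"
  "bidual_act (c *\<^sub>C n) f = c *\<^sub>C bidual_act n f"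
  "bidual_act 0 f = 0"
  by (rule cdual_eqI; simp add: dual_mult_add_left dual_mult_scaleC_left)+

lemma bidual_mult_distrib:
  "(m + n) \<odot> k = m \<odot> k + n \<odot> k"
  "(m - n) \<odot> k = m \<odot> k - n \<odot> k"
  "(- m) \<odot> k = - (m \<odot> k)"
  "0 \<odot> k = 0"
  "(c *\<^sub>C m) \<odot> k = c *\<^sub>C (m \<odot> k)"
  "k \<odot> (m + n) = k \<odot> m + k \<odot> n"
  "k \<odot> (m - n) = k \<odot> m - k \<odot> n"
  "k \<odot> (- m) = - (k \<odot> m)"
  "k \<odot> 0 = 0"
  "k \<odot> (c *\<^sub>C m) = c *\<^sub>C (k \<odot> m)"
  by (rule cdual_eqI; simp add: apply_bidual_mult bidual_act_simps)+

lemma bidual_mult_assoc: "(m \<odot> n) \<odot> k = m \<odot> (n \<odot> k)"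
proof -
  have "dual_mult (bidual_act k f) a = bidual_act k (dual_mult f a)" for f a
    by (rule cdual_eqI) (simp, rule arg_cong[where f = "apply_dual k"], rule cdual_eqI,
        simp add: mult.assoc)
  then have "bidual_act n (bidual_act k f) = bidual_act (n \<odot> k) f" for f
    by (intro cdual_eqI) (simp add: apply_bidual_mult)
  then show ?thesis
    by (intro cdual_eqI) (simp add: apply_bidual_mult)
qed

lemma norm_to_bidual_le: "norm (\<iota> a) \<le> norm a"
  by (rule norm_cdual_bound) (simp, metis apply_to_bidual norm_apply_dual mult.commute)

lemma norm_bidual_mult: "norm (m \<odot> n) \<le> norm m * norm n"
proof (rule norm_cdual_bound)
  fix f
  show "cmod (apply_dual (m \<odot> n) f) \<le> norm m * norm n * norm f"
    using norm_apply_dual[of m "bidual_act n f"]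
      mult_left_mono[OF norm_bidual_act[of n f] norm_ge_zero[of m]]
    by (simp add: apply_bidual_mult mult.assoc)
qed simp

lemma bidual_star_simps:
  "(m + n)\<^sup>\<bullet> = m\<^sup>\<bullet> + n\<^sup>\<bullet>"
  "(m - n)\<^sup>\<bullet> = m\<^sup>\<bullet> - n\<^sup>\<bullet>"
  "(- m)\<^sup>\<bullet> = - m\<^sup>\<bullet>"
  "(c *\<^sub>C m)\<^sup>\<bullet> = cnj c *\<^sub>C m\<^sup>\<bullet>"
  "0\<^sup>\<bullet> = (0 :: 'a::cstar_algebra bidual)"
  by (rule cdual_eqI; simp add: apply_bidual_star)+

lemma norm_bidual_star_le: "norm (m\<^sup>\<bullet>) \<le> norm m"
proof (rule norm_cdual_bound)
  fix f
  show "cmod (apply_dual (m\<^sup>\<bullet>) f) \<le> norm m * norm f"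
    using norm_apply_dual[of m "dual_star f"]
      mult_left_mono[OF norm_dual_star[of f] norm_ge_zero[of m]]
    by (simp add: apply_bidual_star)
qed simp

text \<open>The involution exchanges the two Arens products. They agree when one factor comes from the
  algebra, and so in this case it reverses the product.\<close>

lemma bidual_star_mult_to_bidual:
  "(m \<odot> \<iota> a)\<^sup>\<bullet> = \<iota> (a\<^sup>\<star>) \<odot> m\<^sup>\<bullet>"
proof -
  have "bidual_act (\<iota> a) (dual_star f) = dual_star (dual_mult f (a\<^sup>\<star>))" for f
    by (rule cdual_eqI) (simp add: star_mult)
  then show ?thesis
    by (intro cdual_eqI) (simp add: apply_bidual_star apply_bidual_mult)
qed

lemma bidual_star_to_bidual_mult:
  "(\<iota> a \<odot> m)\<^sup>\<bullet> = m\<^sup>\<bullet> \<odot> \<iota> (a\<^sup>\<star>)"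
  using bidual_star_mult_to_bidual[of "m\<^sup>\<bullet>" "a\<^sup>\<star>"] by (metis bidual_star_star star_star)

section \<open>Elementary consequences of the axioms\<close>

lemma star_zero [simp]: "0\<^sup>\<star> = (0 :: 'a::cstar_algebra)"
  by (metis add_cancel_right_right star_add)

lemma star_minus: "(- x)\<^sup>\<star> = - (x\<^sup>\<star>) " for x :: "'a::cstar_algebra"
  by (metis add.right_inverse add_eq_0_iff star_add star_zero)

lemma star_diff: "(x - y)\<^sup>\<star> = x\<^sup>\<star> - y\<^sup>\<star>" for x :: "'a::cstar_algebra"
  by (metis diff_conv_add_uminus star_add star_minus)

lemma star_scaleR: "(r *\<^sub>R x)\<^sup>\<star> = r *\<^sub>R x\<^sup>\<star>" for x :: "'a::cstar_algebra"
  by (simp add: scaleR_scaleC star_scaleC)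

lemma norm_mult_star: "norm (x * x\<^sup>\<star>) = (norm x)\<^sup>2" for x :: "'a::cstar_algebra"
  by (metis cstar_identity norm_star star_star)

lemma bounded_linear_star: "bounded_linear (star :: 'a::cstar_algebra \<Rightarrow> 'a)"
  by (rule bounded_linear_intro[where K = 1]) (auto simp: star_add star_scaleR norm_star)

lemmas tendsto_star = bounded_linear.tendsto[OF bounded_linear_star]

section \<open>Polynomials of a self-adjoint element\<close>

text \<open>The value at \<open>x\<close> of the operator \<open>p(V)\<close>, by Horner's scheme. Letting \<open>p(V)\<close> act on vectors gives
  a meaning to constant terms in an algebra without unit.\<close>

definition poly_act :: "('k::zero \<Rightarrow> 'a \<Rightarrow> 'a) \<Rightarrow> ('a \<Rightarrow> 'a) \<Rightarrow> 'k poly \<Rightarrow> 'a \<Rightarrow> 'a::ab_group_add" where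
  "poly_act s V p x = fold_coeffs (\<lambda>c y. s c x + V y) p 0"

context
  fixes s :: "'k::comm_ring_1 \<Rightarrow> 'a::ab_group_add \<Rightarrow> 'a" and V :: "'a \<Rightarrow> 'a"
  assumes hom: "module_hom s s V"
begin

interpretation module_hom s s V by (rule hom)

lemma poly_act_0 [simp]: "poly_act s V 0 x = 0"
  by (simp add: poly_act_def)

lemma poly_act_pCons [simp]: "poly_act s V (pCons c p) x = s c x + V (poly_act s V p x)"
  by (cases "c = 0 \<and> p = 0") (auto simp: poly_act_def zero)

lemma poly_act_add: "poly_act s V (p + q) x = poly_act s V p x + poly_act s V q x"
proof (induction p arbitrary: q)
  case (pCons a p)
  obtain b r where "q = pCons b r" by (rule pCons_cases)
  then show ?case
    by (simp add: pCons.IH add m1.scale_left_distrib algebra_simps)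
qed simp

lemma poly_act_smult: "poly_act s V (smult c p) x = s c (poly_act s V p x)"
  by (induction p) (auto simp: scale m1.scale_right_distrib)

lemma poly_act_mult: "poly_act s V (p * q) x = poly_act s V p (poly_act s V q x)"
  by (induction p) (auto simp: poly_act_add poly_act_smult)

lemma poly_act_monom: "poly_act s V (monom c n) x = s c ((V ^^ n) x)"
  by (induction n) (auto simp: monom_0 monom_Suc zero scale)

lemma poly_act_add_right: "poly_act s V p (x + y) = poly_act s V p x + poly_act s V p y"
  by (induction p) (auto simp: m1.scale_right_distrib add algebra_simps)

lemma poly_act_scale_right: "poly_act s V p (s c x) = s c (poly_act s V p x)"
  by (induction p) (auto simp: m1.scale_right_distrib scale mult.commute)

end

abbreviation poly_mult :: "'a::real_normed_algebra \<Rightarrow> real poly \<Rightarrow> 'a \<Rightarrow> 'a" where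
  "poly_mult h \<equiv> poly_act scaleR ((*) h)"

lemma module_hom_mult: "module_hom scaleR scaleR ((*) (h :: 'a::real_normed_algebra))"
  by unfold_locales (auto simp: algebra_simps)

lemmas poly_mult_simps [simp] =
  poly_act_0[OF module_hom_mult] poly_act_pCons[OF module_hom_mult]
lemmas poly_mult_add = poly_act_add[OF module_hom_mult]
  and poly_mult_smult = poly_act_smult[OF module_hom_mult]
  and poly_mult_mult = poly_act_mult[OF module_hom_mult]
  and poly_mult_add_right = poly_act_add_right[OF module_hom_mult]
  and poly_mult_scaleR_right = poly_act_scale_right[OF module_hom_mult]

lemma poly_mult_times: "poly_mult h p (x * y) = poly_mult h p x * y"
  by (induction p) (auto simp: algebra_simps)

lemma poly_mult_diff: "poly_mult h (p - q) x = poly_mult h p x - poly_mult h q x"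
  using poly_mult_add[of h "p - q" q x] by (simp add: algebra_simps)

lemma poly_mult_self: "poly_mult h p (h * x) = h * poly_mult h p x"
  using poly_mult_mult[of h p "[:0, 1:]" x] poly_mult_mult[of h "[:0, 1:]" p x]
  by (simp add: mult.commute)

lemma star_poly_mult:
  fixes h :: "'a::cstar_algebra"
  assumes "h\<^sup>\<star> = h"
  shows "(poly_mult h p x)\<^sup>\<star> * y = x\<^sup>\<star> * poly_mult h p y"
proof (induction p)
  case (pCons a p)
  have "(poly_mult h p x)\<^sup>\<star> * (h * y) = x\<^sup>\<star> * poly_mult h p (h * y)"
    by (induction p arbitrary: y)
      (auto simp: star_add star_scaleR star_mult assms algebra_simps mult.assoc poly_mult_self)
  then show ?case
    by (simp add: star_add star_scaleR star_mult assms algebra_simps mult.assoc poly_mult_self)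
qed simp

lemma clinear_module_hom: "clinear V \<Longrightarrow> module_hom scaleC scaleC V"
  by (simp add: Vector_Spaces.linear_def)

text \<open>The square root of \<open>1 - h\<^sup>2\<close> is written as \<open>1 - w\<close>, so that \<open>w\<close> lives in an algebra
  without unit; then \<open>w\<close> is a fixed point of the contraction \<open>w \<mapsto> (h\<^sup>2 + w\<^sup>2) / 2\<close>.\<close>

lemma sqrt_complement:
  fixes h :: "'a::cstar_algebra"
  assumes h: "h\<^sup>\<star> = h" and less: "norm h < 1"
  obtains w where "w\<^sup>\<star> = w" "w * h = h * w" "w + w = h * h + w * w"
proof -
  define f where "f w = (1/2::real) *\<^sub>R (h * h + w * w)" for w :: 'a
  define S where "S = {w. w\<^sup>\<star> = w \<and> w * h = h * w \<and> norm w \<le> norm h}"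
  have "closed S"
    unfolding S_def
    by (intro closed_Collect_conj closed_Collect_eq closed_Collect_le continuous_intros
        bounded_linear.continuous_on[OF bounded_linear_star])
  then have "complete S" by (simp add: complete_eq_closed)
  moreover have "0 \<in> S" by (simp add: S_def)
  moreover have "f ` S \<subseteq> S"
  proof
    fix v assume "v \<in> f ` S"
    then obtain w where v: "v = f w" and "w\<^sup>\<star> = w" and w: "w * h = h * w" "norm w \<le> norm h"
      by (auto simp: S_def)
    then have star: "v\<^sup>\<star> = v"
      by (simp add: f_def star_scaleR star_add star_mult h)
    have comm: "v * h = h * v"
      using w(1) by (simp add: v f_def algebra_simps) (metis mult.assoc)
    have sq: "norm (h * h) \<le> norm h * norm h" "norm (w * w) \<le> norm h * norm h"
      using norm_mult_ineq[of h h] norm_mult_ineq[of w w] mult_mono[OF w(2) w(2)] by auto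
    have "norm (h * h + w * w) \<le> 2 * (norm h * norm h)"
      using norm_triangle_ineq[of "h * h" "w * w"] sq by linarith
    also have "\<dots> \<le> 2 * norm h"
      using mult_right_mono[of "norm h" 1 "norm h"] less by simp
    finally show "v \<in> S"
      using star comm by (simp add: S_def v f_def)
  qed
  moreover have "dist (f v) (f w) \<le> norm h * dist v w" if "v \<in> S" "w \<in> S" for v w
  proof -
    have "f v - f w = (1/2::real) *\<^sub>R (v * (v - w) + (v - w) * w)"
      by (simp add: f_def algebra_simps)
    then have "norm (f v - f w) \<le> (norm (v * (v - w)) + norm ((v - w) * w)) / 2"
      by (simp add: norm_triangle_ineq)
    also have "\<dots> \<le> (norm h * norm (v - w) + norm (v - w) * norm h) / 2"
      using that
      by (intro divide_right_mono add_mono order_trans[OF norm_mult_ineq] mult_mono)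
        (auto simp: S_def)
    finally show ?thesis by (simp add: dist_norm)
  qed
  ultimately obtain w where "w \<in> S" "f w = w"
    using Banach_fix[of S "norm h" f] less by auto
  then have "w + w = 2 *\<^sub>R f w" by (metis scaleR_2)
  then have "w + w = h * h + w * w" by (simp add: f_def)
  with \<open>w \<in> S\<close> that show thesis by (auto simp: S_def)
qed

text \<open>With \<open>s = 1 - w\<close> the operator \<open>h + i s\<close> is the unitary whose real part is \<open>h\<close>: it acts as
  \<open>exp (i \<theta>)\<close> when \<open>h\<close> acts as \<open>cos \<theta>\<close>.\<close>

lemma unitary_with_real_part:
  fixes h :: "'a::cstar_algebra"
  assumes h: "h\<^sup>\<star> = h" and less: "norm h < 1"
  obtains V :: "'a \<Rightarrow> 'a" where "clinear V" "\<And>x. norm (V x) = norm x"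
    "\<And>x. h * V x = (1/2::complex) *\<^sub>C (V (V x) + x)" "\<And>x. V (h * x) = h * V x"
proof -
  obtain w where w: "w\<^sup>\<star> = w" "w * h = h * w" "w + w = h * h + w * w"
    using sqrt_complement[OF assms] by metis
  have wh: "w * (h * x) = h * (w * x)" and ww: "w * x + w * x = h * (h * x) + w * (w * x)" for x
    using w by (metis mult.assoc, metis distrib_right mult.assoc)
  define V where "V x = h * x + \<i> *\<^sub>C (x - w * x)" for x
  have ii: "\<i> *\<^sub>C \<i> *\<^sub>C x = - x" for x :: 'a
    by (simp add: scaleC_scaleC)
  have half: "(1/2::complex) *\<^sub>C (x + x) = x" for x :: 'a
    by (simp add: scaleC_add_right scaleC_add_left[symmetric])
  have lin: "clinear V"
    by (auto simp: clinear_iff V_def algebra_simps mult_scaleC_right scaleC_add_right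
        scaleC_diff_right scaleC_scaleC)
  have "(V x)\<^sup>\<star> * V x = x\<^sup>\<star> * x" for x
  proof -
    have "(V x)\<^sup>\<star> * V x = x\<^sup>\<star> * (h * (h * x)) + \<i> *\<^sub>C (x\<^sup>\<star> * (h * (x - w * x)))
        - \<i> *\<^sub>C (x\<^sup>\<star> * (h * x - w * (h * x))) + x\<^sup>\<star> * ((x - w * x) - w * (x - w * x))"
      by (simp add: V_def star_add star_scaleC star_mult star_diff h w algebra_simps
          mult_scaleC_right mult_scaleC_left scaleC_scaleC scaleC_diff_right scaleC_add_right
          mult.assoc scaleC_minus_right scaleC_minus_left)
    also have "\<dots> = x\<^sup>\<star> * x + x\<^sup>\<star> * (h * (h * x) + w * (w * x) - (w * x + w * x))"
      by (simp add: wh algebra_simps)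
    finally show ?thesis by (simp add: ww)
  qed
  then have norm: "norm (V x) = norm x" for x
    by (metis cstar_identity norm_ge_zero power2_eq_iff_nonneg)
  have VV: "V (V x) + x = h * V x + h * V x" for x
  proof -
    have "V (V x) + x - (h * V x + h * V x) = (w * x + w * x) - (h * (h * x) + w * (w * x))"
      by (simp add: V_def wh ii algebra_simps mult_scaleC_right scaleC_diff_right scaleC_add_right)
    then show ?thesis by (simp add: ww)
  qed
  have "V (h * x) = h * V x" for x
    by (simp add: V_def wh algebra_simps mult_scaleC_right scaleC_diff_right)
  with lin norm VV half that show thesis by metis
qed

text \<open>Cauchy's inequality for the derivatives of \<open>Q\<close> at 0.\<close>

lemma coeff_bound_unit_circle:
  assumes "\<And>z. cmod z = 1 \<Longrightarrow> cmod (poly Q z) \<le> M"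
  shows "cmod (coeff Q j) \<le> M"
proof -
  have "(deriv ^^ j) (poly Q) = poly ((pderiv ^^ j) Q)"
    by (induction j) (auto intro!: DERIV_imp_deriv poly_DERIV ext)
  moreover have "cmod ((deriv ^^ j) (poly Q) 0) \<le> fact j * M / 1 ^ j"
    by (rule Cauchy_inequality) (auto intro!: holomorphic_intros continuous_intros assms)
  ultimately have "fact j * cmod (coeff Q j) \<le> fact j * M"
    by (simp add: poly_0_coeff_0 coeff_higher_pderiv pochhammer_fact[symmetric] norm_mult)
  then show ?thesis by simp
qed

lemma norm_poly_act_isometry:
  fixes M :: real
  assumes "clinear V" "\<And>x. norm (V x) = norm x" "\<And>j. cmod (coeff Q j) \<le> M"
  shows "norm (poly_act scaleC V Q x) \<le> (degree Q + 1) * M * norm x"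
  using assms(3)
proof (induction Q)
  case 0
  then have "0 \<le> M" by simp
  then show ?case by (simp add: poly_act_0[OF clinear_module_hom[OF assms(1)]])
next
  case (pCons c Q)
  note [simp] = poly_act_0[OF clinear_module_hom[OF assms(1)]]
    poly_act_pCons[OF clinear_module_hom[OF assms(1)]]
  have c: "cmod c \<le> M" using pCons.prems[of 0] by simp
  have "cmod (coeff Q j) \<le> M" for j using pCons.prems[of "Suc j"] by simp
  then have IH: "norm (poly_act scaleC V Q x) \<le> (degree Q + 1) * M * norm x"
    by (rule pCons.IH)
  have c': "cmod c * norm x \<le> M * norm x" by (rule mult_right_mono[OF c]) simp
  have "norm (poly_act scaleC V (pCons c Q) x) \<le> cmod c * norm x + norm (poly_act scaleC V Q x)"
    using norm_triangle_ineq[of "c *\<^sub>C x" "V (poly_act scaleC V Q x)"]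
    by (simp add: norm_scaleC assms(2))
  also have "\<dots> \<le> (degree (pCons c Q) + 1) * M * norm x"
  proof (cases "Q = 0")
    case True
    then show ?thesis using c' by simp
  next
    case False
    then show ?thesis using IH c' by (simp add: algebra_simps)
  qed
  finally show ?case .
qed

lemma clinear_funpow: "clinear (V :: 'a \<Rightarrow> 'a::complex_normed_vector) \<Longrightarrow> clinear (V ^^ n)"
  by (induction n) (auto simp: clinear_iff)

text \<open>On the unit circle \<open>Re z = (z\<^sup>2 + 1) / (2 z)\<close>, so that \<open>z ^ n * p (Re z)\<close> is a polynomial \<open>Q\<close>
  in \<open>z\<close> when \<open>n\<close> is the degree of \<open>p\<close>; the same computation holds for a unitary in place of \<open>z\<close>.\<close>

lemma laurent_form:
  fixes h :: "'a::cstar_algebra"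
  assumes V: "clinear V" "\<And>x. h * V x = (1/2::complex) *\<^sub>C (V (V x) + x)"
    and comm: "\<And>x. V (h * x) = h * V x"
  shows "\<exists>Q. degree Q \<le> 2 * degree p
    \<and> (\<forall>z. cmod z = 1 \<longrightarrow> poly Q z = z ^ degree p * of_real (poly p (Re z)))
    \<and> (\<forall>x. (V ^^ degree p) (poly_mult h p x) = poly_act scaleC V Q x)"
proof (induction p)
  case 0
  show ?case
    by (intro exI[of _ 0]) (simp add: poly_act_0[OF clinear_module_hom[OF V(1)]])
next
  case (pCons a p)
  note hom = clinear_module_hom[OF V(1)]
  note [simp] = poly_act_0[OF hom] poly_act_pCons[OF hom]
  have V_simps: "V (x + y) = V x + V y" "V (c *\<^sub>C x) = c *\<^sub>C V x" for x y c
    using V(1) by (simp_all add: clinear_iff)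
  note [simp] = module_hom.zero[OF hom]
  have Vn: "(V ^^ n) (x + y) = (V ^^ n) x + (V ^^ n) y"
    "(V ^^ n) (c *\<^sub>C x) = c *\<^sub>C (V ^^ n) x" for n x y c
    using clinear_funpow[OF V(1), of n] by (simp_all add: clinear_iff)
  show ?case
  proof (cases "p = 0")
    case True
    then show ?thesis
      by (intro exI[of _ "[:of_real a:]"]) (simp flip: scaleR_scaleC)
  next
    case False
    define n where "n = degree p"
    obtain Q where Q: "degree Q \<le> 2 * n"
      "\<And>z. cmod z = 1 \<Longrightarrow> poly Q z = z ^ n * of_real (poly p (Re z))"
      "\<And>x. (V ^^ n) (poly_mult h p x) = poly_act scaleC V Q x"
      using pCons.IH n_def by blast
    define Q' where "Q' = monom (of_real a) (Suc n) + smult (1/2) (Q + pCons 0 (pCons 0 Q))"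
    have "degree (pCons 0 (pCons 0 Q)) \<le> 2 * Suc n"
      using Q(1) by (auto simp: degree_pCons_eq_if)
    then have "degree Q' \<le> 2 * Suc n"
      unfolding Q'_def using Q(1)
      by (intro degree_add_le order_trans[OF degree_monom_le] order_trans[OF degree_smult_le])
        auto
    moreover have "poly Q' z = z ^ Suc n * of_real (poly (pCons a p) (Re z))" if "cmod z = 1" for z
    proof -
      have "z * cnj z = 1" using that by (simp flip: complex_norm_square)
      then have "z * (z + cnj z) = z * z + 1" by (simp add: distrib_left)
      then have re: "z * of_real (Re z) = (z * z + 1) / 2" by (simp add: complex_add_cnj algebra_simps)
      have "poly Q' z = of_real a * z ^ Suc n + (z * z + 1) / 2 * poly Q z"
        by (simp add: Q'_def poly_monom algebra_simps)
      also have "\<dots> = z ^ Suc n * (of_real a + of_real (Re z) * of_real (poly p (Re z)))"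
        unfolding re[symmetric] Q(2)[OF that] by (simp add: algebra_simps)
      finally show ?thesis by simp
    qed
    moreover have "(V ^^ Suc n) (poly_mult h (pCons a p) x) = poly_act scaleC V Q' x" for x
    proof -
      define y where "y = poly_mult h p x"
      have Q_step: "poly_mult h (pCons a p) x = of_real a *\<^sub>C x + h * y"
        by (simp add: y_def scaleR_scaleC[of a x])
      have "(V ^^ Suc n) (poly_mult h (pCons a p) x)
        = of_real a *\<^sub>C (V ^^ Suc n) x + (V ^^ n) (V (h * y))"
        unfolding Q_step by (simp add: Vn V_simps funpow_swap1)
      also have "V (h * y) = (1/2) *\<^sub>C (V (V y) + y)"
        by (simp add: comm V(2))
      also have "(V ^^ n) \<dots> = (1/2) *\<^sub>C (V (V ((V ^^ n) y)) + (V ^^ n) y)"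
        by (simp add: Vn funpow_swap1)
      also have "(V ^^ n) y = poly_act scaleC V Q x"
        by (simp add: y_def Q(3))
      finally show ?thesis
        by (simp add: Q'_def poly_act_add[OF hom] poly_act_smult[OF hom] poly_act_monom[OF hom]
            V_simps add.commute)
    qed
    ultimately show ?thesis
      using False by (intro exI[of _ Q']) (simp add: n_def)
  qed
qed

text \<open>The polynomial of the Laurent form has at most \<open>2 n + 1\<close> coefficients, each bounded by the maximum
  of \<open>\<bar>p\<bar>\<close> on \<open>[-1, 1]\<close>, and powers of the unitary preserve the norm.\<close>

lemma norm_poly_mult_degree:
  fixes h :: "'a::cstar_algebra" and M :: real
  assumes h: "h\<^sup>\<star> = h" "norm h < 1" and M: "\<And>t. \<bar>t\<bar> \<le> 1 \<Longrightarrow> \<bar>poly p t\<bar> \<le> M"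
  shows "norm (poly_mult h p x) \<le> (2 * degree p + 1) * M * norm x"
proof -
  obtain V where V: "clinear V" "\<And>x. norm (V x) = norm x"
    "\<And>x. h * V x = (1/2::complex) *\<^sub>C (V (V x) + x)" "\<And>x. V (h * x) = h * V x"
    using unitary_with_real_part[OF h] by metis
  obtain Q where Q: "degree Q \<le> 2 * degree p"
    "\<And>z. cmod z = 1 \<Longrightarrow> poly Q z = z ^ degree p * of_real (poly p (Re z))"
    "\<And>x. (V ^^ degree p) (poly_mult h p x) = poly_act scaleC V Q x"
    using laurent_form[OF V(1,3,4)] by metis
  have "cmod (poly Q z) \<le> M" if "cmod z = 1" for z
    using M[of "Re z"] abs_Re_le_cmod[of z] that
    by (simp add: Q(2) norm_mult norm_power)
  then have "norm (poly_act scaleC V Q x) \<le> (degree Q + 1) * M * norm x"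
    by (intro norm_poly_act_isometry[OF V(1,2)] coeff_bound_unit_circle)
  moreover have "norm ((V ^^ n) y) = norm y" for n y
    by (induction n) (auto simp: V(2))
  ultimately have "norm (poly_mult h p x) \<le> (degree Q + 1) * M * norm x"
    by (metis Q(3))
  also have "\<dots> \<le> (2 * degree p + 1) * M * norm x"
    using Q(1) M[of 0] by (intro mult_right_mono) auto
  finally show ?thesis .
qed

text \<open>The linear factor \<open>2 n + 1\<close> disappears by taking powers: a self-adjoint operator satisfies
  \<open>\<parallel>A x\<parallel>\<^sup>2 \<le> \<parallel>x\<parallel> \<parallel>A\<^sup>2 x\<parallel>\<close>, and the degree of \<open>p ^ m\<close> grows only linearly in \<open>m\<close>.\<close>

lemma norm_poly_mult_power:
  fixes h :: "'a::cstar_algebra"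
  assumes h: "h\<^sup>\<star> = h" and x: "norm x = 1"
  shows "norm (poly_mult h p x) ^ (2 ^ n) \<le> norm (poly_mult h (p ^ (2 ^ n)) x)"
proof (induction n)
  case (Suc n)
  let ?q = "p ^ (2 ^ n)"
  have "norm (poly_mult h p x) ^ (2 ^ Suc n) = (norm (poly_mult h p x) ^ (2 ^ n))\<^sup>2"
    by (simp add: power_mult[symmetric] mult.commute)
  also have "\<dots> \<le> (norm (poly_mult h ?q x))\<^sup>2"
    by (rule power_mono[OF Suc]) simp
  also have "\<dots> = norm (x\<^sup>\<star> * poly_mult h ?q (poly_mult h ?q x))"
    by (simp add: cstar_identity[symmetric] star_poly_mult[OF h])
  also have "\<dots> \<le> norm (poly_mult h (?q * ?q) x)"
    using norm_mult_ineq[of "x\<^sup>\<star>"] by (simp add: norm_star x poly_mult_mult)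
  also have "?q * ?q = p ^ (2 ^ Suc n)"
    by (simp add: mult_2 power_add)
  finally show ?case .
qed simp

lemma le_one_if_powers_le_linear:
  fixes r K :: real
  assumes "0 \<le> r" "\<And>n. r ^ (2 ^ n) \<le> K * 2 ^ n"
  shows "r \<le> 1"
proof (rule ccontr)
  assume "\<not> r \<le> 1"
  then have r: "1 < r" by simp
  have "(\<lambda>n. of_nat n * inverse r ^ n) \<longlonglongrightarrow> 0"
    using r by (intro powser_times_n_limit_0) (simp add: inverse_eq_divide)
  moreover have "strict_mono (\<lambda>n. 2 ^ n :: nat)"
    by (simp add: strict_mono_def)
  ultimately have "((\<lambda>n. of_nat n * inverse r ^ n) \<circ> (\<lambda>n. 2 ^ n)) \<longlonglongrightarrow> 0"
    by (rule LIMSEQ_subseq_LIMSEQ)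
  then have "(\<lambda>n. K * (2 ^ n * inverse r ^ (2 ^ n))) \<longlonglongrightarrow> K * 0"
    by (intro tendsto_mult_left) (simp add: o_def)
  then have "eventually (\<lambda>n. K * (2 ^ n * inverse r ^ (2 ^ n)) < 1) sequentially"
    by (rule order_tendstoD) simp
  then obtain n where "K * (2 ^ n * inverse r ^ (2 ^ n)) < 1"
    by (auto simp: eventually_sequentially)
  moreover have "inverse r ^ (2 ^ n) = inverse (r ^ (2 ^ n))"
    by (simp add: power_inverse)
  moreover have "0 < r ^ (2 ^ n)" using r by simp
  ultimately show False
    using assms(2)[of n] by (simp add: field_simps)
qed

theorem norm_poly_mult_le:
  fixes h :: "'a::cstar_algebra" and M :: real
  assumes h: "h\<^sup>\<star> = h" "norm h < 1" and M: "\<And>t. \<bar>t\<bar> \<le> 1 \<Longrightarrow> \<bar>poly p t\<bar> \<le> M"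
  shows "norm (poly_mult h p x) \<le> M * norm x"
proof (cases "x = 0")
  case True
  then show ?thesis using poly_mult_scaleR_right[of h p 0 x] by simp
next
  case False
  define y where "y = inverse (norm x) *\<^sub>R x"
  have y: "norm y = 1" using False by (simp add: y_def)
  have "norm (poly_mult h p y) \<le> N" if "M < N" for N
  proof -
    \<comment> \<open>\<open>M\<close> may be 0; any larger \<open>N\<close> can be divided by.\<close>
    have N: "0 < N" using that M[of 0] by simp
    have "(norm (poly_mult h p y) / N) ^ (2 ^ n) \<le> real (2 * degree p + 1) * 2 ^ n" for n
    proof -
      have "\<bar>poly (p ^ (2 ^ n)) t\<bar> \<le> N ^ (2 ^ n)" if "\<bar>t\<bar> \<le> 1" for t
        using power_mono[of "\<bar>poly p t\<bar>" N "2 ^ n"] M[OF that] \<open>M < N\<close>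
        by (simp add: power_abs)
      note bound = norm_poly_mult_degree[OF h this, of y]
      have "2 * degree (p ^ (2 ^ n)) + 1 \<le> (2 * degree p + 1) * 2 ^ n"
        using add_mono[OF mult_left_mono[OF degree_power_le[of p "2 ^ n"], of 2] one_le_power[of 2 n]]
        by (simp add: algebra_simps)
      then have "real (2 * degree (p ^ (2 ^ n)) + 1) \<le> real ((2 * degree p + 1) * 2 ^ n)"
        by (rule of_nat_mono)
      then have deg: "real (2 * degree (p ^ (2 ^ n)) + 1) \<le> real (2 * degree p + 1) * 2 ^ n"
        by (simp add: algebra_simps)
      from bound
      have "norm (poly_mult h p y) ^ (2 ^ n) \<le> (2 * degree (p ^ (2 ^ n)) + 1) * N ^ (2 ^ n)"
        using norm_poly_mult_power[OF h(1) y, of p n] y by simp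
      also have "\<dots> \<le> real (2 * degree p + 1) * 2 ^ n * N ^ (2 ^ n)"
        using deg N by (intro mult_right_mono) auto
      finally show ?thesis
        using N by (simp add: power_divide field_simps)
    qed
    from le_one_if_powers_le_linear[OF _ this]
    have "norm (poly_mult h p y) / N \<le> 1"
      using N by simp
    then show ?thesis using N by simp
  qed
  then have "norm (poly_mult h p y) \<le> M" by (rule dense_ge)
  then show ?thesis
    using False by (simp add: y_def poly_mult_scaleR_right field_simps)
qed

section \<open>Continuous functions of a self-adjoint element\<close>

abbreviation cont :: "(real \<Rightarrow> real) \<Rightarrow> bool" where
  "cont f \<equiv> continuous_on {-1..1} f"

lemma uniform_poly_approx:
  assumes "cont f"
  shows "\<exists>P. uniform_limit {-1..1} (\<lambda>n. poly (P n)) f sequentially"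
proof -
  have "\<exists>p. \<forall>t\<in>{-1..1}. dist (poly p t) (f t) < 1 / Suc n" for n
  proof -
    obtain g where g: "real_polynomial_function g" "\<And>t. t \<in> {-1..1} \<Longrightarrow> \<bar>f t - g t\<bar> < 1 / Suc n"
      using Stone_Weierstrass_real_polynomial_function[OF compact_Icc assms, of "1 / Suc n"]
      by auto
    obtain a m where "g = (\<lambda>x. \<Sum>i\<le>m. a i * x ^ i)"
      using g(1) by (auto simp: real_polynomial_function_iff_sum)
    then have "poly (\<Sum>i\<le>m. monom (a i) i) t = g t" for t
      by (simp add: poly_sum poly_monom)
    with g(2) show ?thesis by (metis dist_commute dist_real_def)
  qed
  then obtain P where P: "\<And>n t. t \<in> {-1..1} \<Longrightarrow> dist (poly (P n) t) (f t) < 1 / Suc n"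
    by metis
  have "uniform_limit {-1..1} (\<lambda>n. poly (P n)) f sequentially"
  proof (rule uniform_limitI)
    fix e :: real assume "0 < e"
    then have "\<forall>\<^sub>F n in sequentially. 1 / real (Suc n) < e"
      using order_tendstoD(2)[OF LIMSEQ_inverse_real_of_nat] by (simp add: inverse_eq_divide)
    then show "\<forall>\<^sub>F n in sequentially. \<forall>t\<in>{-1..1}. dist (poly (P n) t) (f t) < e"
      by eventually_elim (intro ballI, rule less_trans[OF P], assumption+)
  qed
  then show ?thesis by blast
qed

lemma poly_fun:
  "poly (p + q) = (\<lambda>t. poly p t + poly q t)"
  "poly (p * q) = (\<lambda>t. poly p t * poly q t)"
  "poly (smult c p) = (\<lambda>t. c * poly p t)"
  by auto

text \<open>The operator \<open>f(h)\<close>, as a limit along some sequence of polynomials that converges to \<open>f\<close>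
  uniformly on \<open>[-1, 1]\<close>; by \<open>LIMSEQ_cont_mult\<close> every such sequence gives the same limit.\<close>

definition cont_mult :: "'a::cstar_algebra \<Rightarrow> (real \<Rightarrow> real) \<Rightarrow> 'a \<Rightarrow> 'a" where
  "cont_mult h f x = lim (\<lambda>n. poly_mult h
    ((SOME P. uniform_limit {-1..1} (\<lambda>n. poly (P n)) f sequentially) n) x)"

context
  fixes h :: "'a::cstar_algebra"
  assumes h: "h\<^sup>\<star> = h" "norm h < 1"
begin

lemma norm_poly_mult_diff_le:
  assumes "\<And>t. t \<in> {-1..1} \<Longrightarrow> dist (poly p t) (poly q t) \<le> M"
  shows "norm (poly_mult h p x - poly_mult h q x) \<le> M * norm x"
  unfolding poly_mult_diff[symmetric]
  by (rule norm_poly_mult_le[OF h]) (use assms in \<open>auto simp: dist_real_def abs_le_iff\<close>)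

lemma poly_mult_uniform_limit_diff:
  assumes P: "uniform_limit {-1..1} (\<lambda>n. poly (P n)) f sequentially"
    and Q: "uniform_limit {-1..1} (\<lambda>n. poly (Q n)) f sequentially" and e: "0 < e"
  shows "\<exists>N. \<forall>m\<ge>N. \<forall>n\<ge>N. norm (poly_mult h (P m) x - poly_mult h (Q n) x) < e"
proof -
  define d where "d = e / (2 * (norm x + 1))"
  have nx: "0 < norm x + 1" by (rule add_nonneg_pos) auto
  then have d: "0 < d" using e by (simp add: d_def)
  obtain N where N: "\<And>n t. N \<le> n \<Longrightarrow> t \<in> {-1..1} \<Longrightarrow> dist (poly (P n) t) (f t) < d"
    "\<And>n t. N \<le> n \<Longrightarrow> t \<in> {-1..1} \<Longrightarrow> dist (poly (Q n) t) (f t) < d"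
    using eventually_conj[OF uniform_limitD[OF P d] uniform_limitD[OF Q d]]
    unfolding eventually_sequentially by blast
  have "norm (poly_mult h (P m) x - poly_mult h (Q n) x) < e" if "N \<le> m" "N \<le> n" for m n
  proof -
    have "dist (poly (P m) t) (poly (Q n) t) \<le> 2 * d" if "t \<in> {-1..1}" for t
      using N(1)[OF \<open>N \<le> m\<close> that] N(2)[OF \<open>N \<le> n\<close> that]
        dist_triangle2[of "poly (P m) t" "poly (Q n) t" "f t"] by linarith
    then have "norm (poly_mult h (P m) x - poly_mult h (Q n) x) \<le> 2 * d * norm x"
      by (rule norm_poly_mult_diff_le)
    also have "\<dots> < 2 * d * (norm x + 1)" using d by simp
    also have "\<dots> = e" using nx by (simp add: d_def field_simps)
    finally show ?thesis .
  qed
  then show ?thesis by blast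
qed

lemma LIMSEQ_cont_mult:
  assumes P: "uniform_limit {-1..1} (\<lambda>n. poly (P n)) f sequentially"
  shows "(\<lambda>n. poly_mult h (P n) x) \<longlonglongrightarrow> cont_mult h f x"
proof -
  define Q where "Q = (SOME P. uniform_limit {-1..1} (\<lambda>n. poly (P n)) f sequentially)"
  have Q: "uniform_limit {-1..1} (\<lambda>n. poly (Q n)) f sequentially"
    unfolding Q_def by (rule someI[of _ P]) (rule P)
  have "Cauchy (\<lambda>n. poly_mult h (Q n) x)"
    by (rule CauchyI) (rule poly_mult_uniform_limit_diff[OF Q Q])
  then have lim: "(\<lambda>n. poly_mult h (Q n) x) \<longlonglongrightarrow> cont_mult h f x"
    unfolding cont_mult_def Q_def[symmetric] convergent_LIMSEQ_iff[symmetric]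
    by (rule Cauchy_convergent)
  have "(\<lambda>n. poly_mult h (P n) x - poly_mult h (Q n) x) \<longlonglongrightarrow> 0"
  proof (rule LIMSEQ_I)
    fix e :: real assume "0 < e"
    from poly_mult_uniform_limit_diff[OF P Q this, of x]
    show "\<exists>N. \<forall>n\<ge>N. norm (poly_mult h (P n) x - poly_mult h (Q n) x - 0) < e"
      by auto
  qed
  from tendsto_add[OF this lim] show ?thesis by simp
qed

lemma cont_mult_poly: "cont_mult h (poly p) x = poly_mult h p x"
  using LIMSEQ_cont_mult[of "\<lambda>_. p" "poly p" x] by (simp add: LIMSEQ_const_iff uniform_limit_const)

lemma cont_mult_one: "cont_mult h (\<lambda>_. 1) x = x"
proof -
  have "poly [:1:] = (\<lambda>_. 1 :: real)" by auto
  then show ?thesis using cont_mult_poly[of "[:1:]" x] by simp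
qed

lemma cont_mult_id: "cont_mult h (\<lambda>t. t) x = h * x"
proof -
  have "poly [:0, 1:] = (\<lambda>t. t :: real)" by auto
  then show ?thesis using cont_mult_poly[of "[:0, 1:]" x] by simp
qed

lemma cont_mult_add:
  assumes "cont f" "cont g"
  shows "cont_mult h (\<lambda>t. f t + g t) x = cont_mult h f x + cont_mult h g x"
proof -
  obtain P Q where PQ: "uniform_limit {-1..1} (\<lambda>n. poly (P n)) f sequentially"
    "uniform_limit {-1..1} (\<lambda>n. poly (Q n)) g sequentially"
    using uniform_poly_approx[OF assms(1)] uniform_poly_approx[OF assms(2)] by blast
  then have "uniform_limit {-1..1} (\<lambda>n t. poly (P n) t + poly (Q n) t) (\<lambda>t. f t + g t) sequentially"
    by (rule uniform_limit_add)
  then have "(\<lambda>n. poly_mult h (P n + Q n) x) \<longlonglongrightarrow> cont_mult h (\<lambda>t. f t + g t) x"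
    by (intro LIMSEQ_cont_mult) (simp add: poly_fun)
  moreover have "(\<lambda>n. poly_mult h (P n + Q n) x) \<longlonglongrightarrow> cont_mult h f x + cont_mult h g x"
    unfolding poly_mult_add by (intro tendsto_add LIMSEQ_cont_mult PQ)
  ultimately show ?thesis by (rule LIMSEQ_unique)
qed

lemma star_cont_mult:
  assumes "cont f" "cont g"
  shows "(cont_mult h f x)\<^sup>\<star> * cont_mult h g y = x\<^sup>\<star> * cont_mult h (\<lambda>t. f t * g t) y"
proof -
  obtain P Q where PQ: "uniform_limit {-1..1} (\<lambda>n. poly (P n)) f sequentially"
    "uniform_limit {-1..1} (\<lambda>n. poly (Q n)) g sequentially"
    using uniform_poly_approx[OF assms(1)] uniform_poly_approx[OF assms(2)] by blast
  then have "uniform_limit {-1..1} (\<lambda>n t. poly (P n) t * poly (Q n) t) (\<lambda>t. f t * g t) sequentially"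
    by (intro uniform_lim_mult compact_imp_bounded compact_continuous_image assms compact_Icc)
  then have "(\<lambda>n. x\<^sup>\<star> * poly_mult h (P n * Q n) y) \<longlonglongrightarrow> x\<^sup>\<star> * cont_mult h (\<lambda>t. f t * g t) y"
    by (intro tendsto_intros LIMSEQ_cont_mult) (simp add: poly_fun)
  moreover have "(\<lambda>n. (poly_mult h (P n) x)\<^sup>\<star> * poly_mult h (Q n) y)
      \<longlonglongrightarrow> (cont_mult h f x)\<^sup>\<star> * cont_mult h g y"
    by (intro tendsto_mult tendsto_star LIMSEQ_cont_mult PQ)
  ultimately show ?thesis
    by (simp add: star_poly_mult[OF h(1)] poly_mult_mult LIMSEQ_unique)
qed

lemma norm_cont_mult_le:
  assumes "cont f" "\<And>t. t \<in> {-1..1} \<Longrightarrow> \<bar>f t\<bar> \<le> M"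
  shows "norm (cont_mult h f x) \<le> M * norm x"
proof -
  obtain P where P: "uniform_limit {-1..1} (\<lambda>n. poly (P n)) f sequentially"
    using uniform_poly_approx[OF assms(1)] by blast
  have "norm (cont_mult h f x) \<le> N * norm x" if "M < N" for N
  proof (rule tendsto_upperbound)
    show "(\<lambda>n. norm (poly_mult h (P n) x)) \<longlonglongrightarrow> norm (cont_mult h f x)"
      by (intro tendsto_norm LIMSEQ_cont_mult P)
    show "\<forall>\<^sub>F n in sequentially. norm (poly_mult h (P n) x) \<le> N * norm x"
      using uniform_limitD[OF P, of "N - M"] that
    proof (simp, elim eventually_mono)
      fix n assume n: "\<forall>t\<in>{-1..1}. dist (poly (P n) t) (f t) < N - M"
      show "norm (poly_mult h (P n) x) \<le> N * norm x"
      proof (rule norm_poly_mult_le[OF h])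
        fix t :: real assume "\<bar>t\<bar> \<le> 1"
        then have t: "t \<in> {-1..1}" by auto
        show "\<bar>poly (P n) t\<bar> \<le> N"
          using bspec[OF n t] assms(2)[OF t] unfolding dist_real_def by linarith
      qed
    qed
  qed simp
  note le = this
  show ?thesis
  proof (cases "x = 0")
    case True
    then show ?thesis using le[of "M + 1"] by simp
  next
    case False
    have "norm (cont_mult h f x) / norm x \<le> N" if "M < N" for N
      using le[OF that] False by (simp add: divide_le_eq)
    then have "norm (cont_mult h f x) / norm x \<le> M" by (rule dense_ge)
    then show ?thesis using False by (simp add: divide_le_eq)
  qed
qed

lemma cont_mult_scale:
  assumes "cont f"
  shows "cont_mult h (\<lambda>t. c * f t) x = c *\<^sub>R cont_mult h f x"
proof -
  obtain P where P: "uniform_limit {-1..1} (\<lambda>n. poly (P n)) f sequentially"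
    using uniform_poly_approx[OF assms(1)] by blast
  have "uniform_limit {-1..1} (\<lambda>n t. c * poly (P n) t) (\<lambda>t. c * f t) sequentially"
    by (rule bounded_linear.uniform_limit[OF bounded_linear_mult_right P])
  then have "(\<lambda>n. poly_mult h (smult c (P n)) x) \<longlonglongrightarrow> cont_mult h (\<lambda>t. c * f t) x"
    by (intro LIMSEQ_cont_mult) (simp add: poly_fun)
  moreover have "(\<lambda>n. poly_mult h (smult c (P n)) x) \<longlonglongrightarrow> c *\<^sub>R cont_mult h f x"
    unfolding poly_mult_smult by (intro tendsto_scaleR tendsto_const LIMSEQ_cont_mult P)
  ultimately show ?thesis by (rule LIMSEQ_unique)
qed

end

section \<open>Bilinear maps that vanish on orthogonal pairs\<close>

definition clamp01 :: "real \<Rightarrow> real" where "clamp01 u = max 0 (min 1 u)"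

lemma clamp01_bounds: "0 \<le> clamp01 u" "clamp01 u \<le> 1" "\<bar>clamp01 u\<bar> \<le> 1"
  by (auto simp: clamp01_def)

lemma cont_clamp01: "continuous_on S f \<Longrightarrow> continuous_on S (\<lambda>t. clamp01 (f t))"
  unfolding clamp01_def by (intro continuous_intros)

text \<open>The sum is a continuous staircase: its steps have height 1, and it rises only where \<open>z\<close> is
  within \<open>1/6\<close> of an integer.\<close>

lemma staircase_approx:
  fixes z :: real
  assumes "0 \<le> z" "z + 1 \<le> real K"
  shows "\<bar>(\<Sum>m<K. clamp01 (1/2 + 3 * (z - real m))) - z\<bar> \<le> 2"
proof -
  define k where "k = nat \<lfloor>z\<rfloor>"
  have k: "real k \<le> z" "z < real k + 1" using assms(1) by (auto simp: k_def)
  have "k < K" using k(1) assms(2) by linarith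
  have "real k = (\<Sum>m<k. 1)" by simp
  also have "\<dots> \<le> (\<Sum>m<k. clamp01 (1/2 + 3 * (z - real m)))"
  proof (rule sum_mono)
    fix m assume "m \<in> {..<k}"
    then have "real m + 1 \<le> z" using k(1) by (simp add: less_eq_Suc_le flip: of_nat_Suc)
    then show "1 \<le> clamp01 (1/2 + 3 * (z - real m))" by (simp add: clamp01_def)
  qed
  also have "\<dots> \<le> (\<Sum>m<K. clamp01 (1/2 + 3 * (z - real m)))"
    using \<open>k < K\<close> by (intro sum_mono2) (auto simp: clamp01_bounds)
  finally have low: "real k \<le> (\<Sum>m<K. clamp01 (1/2 + 3 * (z - real m)))" .
  have "(\<Sum>m<K. clamp01 (1/2 + 3 * (z - real m))) \<le> (\<Sum>m<K. if m < k + 2 then 1 else 0)"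
  proof (rule sum_mono)
    fix m
    have "z + 1 \<le> real m" if "\<not> m < k + 2"
      using that k(2) by linarith
    then show "clamp01 (1/2 + 3 * (z - real m)) \<le> (if m < k + 2 then 1 else 0)"
      by (auto simp: clamp01_bounds clamp01_def)
  qed
  also have "\<dots> = real (card ({..<K} \<inter> {..<k + 2}))"
    by (simp add: sum.If_cases lessThan_def)
  also have "\<dots> \<le> real (k + 2)"
    by (metis card_lessThan card_mono finite_lessThan inf_le2 of_nat_mono)
  finally show ?thesis using low k by simp
qed

text \<open>Where a ramp of the staircase is strictly between 0 and 1, the distance to an integer is at most
  \<open>1/6\<close>, and so the cosine is at least \<open>1/2\<close>.\<close>

lemma staircase_cos:
  fixes u :: real
  assumes "clamp01 (1/2 + 3 * (u - real m)) \<noteq> 0" "clamp01 (1/2 + 3 * (u - real m)) \<noteq> 1"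
  shows "clamp01 (1/2 - cos (2 * pi * u)) = 0"
proof -
  define v where "v = 2 * pi * (u - real m)"
  have "0 < 1/2 + 3 * (u - real m)" "1/2 + 3 * (u - real m) < 1"
    using assms by (auto simp: clamp01_def max_def min_def split: if_splits)
  then have "\<bar>u - real m\<bar> \<le> 1/6" unfolding abs_le_iff by (auto simp: field_simps)
  then have "2 * pi * \<bar>u - real m\<bar> \<le> 2 * pi * (1/6)"
    by (intro mult_left_mono) auto
  then have "\<bar>v\<bar> \<le> pi / 3" by (simp add: v_def abs_mult)
  then have "cos (pi / 3) \<le> cos \<bar>v\<bar>"
    using pi_gt_zero by (intro cos_monotone_0_pi_le) auto
  moreover have "cos v = cos (2 * pi * u)"
  proof -
    have "v = 2 * pi * u - 2 * real m * pi" by (simp add: v_def algebra_simps)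
    moreover have "cos (2 * pi * u - 2 * real m * pi) = cos (2 * pi * u)"
      by (simp only: cos_diff cos_2npi sin_2npi mult_1_right mult_zero_right add_0_right)
    ultimately show ?thesis by simp
  qed
  ultimately show ?thesis by (simp add: clamp01_def cos_60)
qed

text \<open>The following properties of \<open>\<psi>\<close> are those of \<open>\<psi> f g = B (f(h) a) (g(h) b)\<close> when \<open>B\<close> vanishes on
  orthogonal pairs.\<close>

context
  fixes \<psi> :: "(real \<Rightarrow> real) \<Rightarrow> (real \<Rightarrow> real) \<Rightarrow> 'b::real_normed_vector" and C :: real
  assumes add_left: "\<And>f f' g. cont f \<Longrightarrow> cont f' \<Longrightarrow> cont g \<Longrightarrow> \<psi> (\<lambda>t. f t + f' t) g = \<psi> f g + \<psi> f' g"
    and add_right: "\<And>f g g'. cont f \<Longrightarrow> cont g \<Longrightarrow> cont g' \<Longrightarrow> \<psi> f (\<lambda>t. g t + g' t) = \<psi> f g + \<psi> f g'"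
    and scale_left: "\<And>c f g. cont f \<Longrightarrow> cont g \<Longrightarrow> \<psi> (\<lambda>t. c * f t) g = c *\<^sub>R \<psi> f g"
    and scale_right: "\<And>c f g. cont f \<Longrightarrow> cont g \<Longrightarrow> \<psi> f (\<lambda>t. c * g t) = c *\<^sub>R \<psi> f g"
    and bound: "\<And>f g M N. cont f \<Longrightarrow> cont g \<Longrightarrow> (\<And>t. t \<in> {-1..1} \<Longrightarrow> \<bar>f t\<bar> \<le> M) \<Longrightarrow>
      (\<And>t. t \<in> {-1..1} \<Longrightarrow> \<bar>g t\<bar> \<le> N) \<Longrightarrow> norm (\<psi> f g) \<le> C * M * N"
    and orthogonal: "\<And>f g. cont f \<Longrightarrow> cont g \<Longrightarrow> (\<And>t. t \<in> {-1..1} \<Longrightarrow> f t * g t = 0) \<Longrightarrow> \<psi> f g = 0"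
begin

text \<open>The defect from moving a factor \<open>s\<close> across the pair \<open>(f, 1)\<close>.\<close>

definition exchange_defect :: "(real \<Rightarrow> real) \<Rightarrow> (real \<Rightarrow> real) \<Rightarrow> 'b" where
  "exchange_defect s f = \<psi> (\<lambda>t. s t * f t) (\<lambda>_. 1) - \<psi> f s"

lemma exchange_defect_add:
  assumes "cont s" "cont s'" "cont f"
  shows "exchange_defect (\<lambda>t. s t + s' t) f = exchange_defect s f + exchange_defect s' f"
proof -
  have "(\<lambda>t. (s t + s' t) * f t) = (\<lambda>t. s t * f t + s' t * f t)"
    by (simp add: algebra_simps)
  then show ?thesis
    using assms by (simp add: exchange_defect_def add_left add_right continuous_on_mult)
qed

lemma exchange_defect_scale:
  assumes "cont s" "cont f"
  shows "exchange_defect (\<lambda>t. c * s t) f = c *\<^sub>R exchange_defect s f"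
  using assms by (simp add: exchange_defect_def scale_left scale_right continuous_on_mult mult.assoc algebra_simps)

lemma exchange_defect_add_right:
  assumes "cont s" "cont f" "cont f'"
  shows "exchange_defect s (\<lambda>t. f t + f' t) = exchange_defect s f + exchange_defect s f'"
proof -
  have "(\<lambda>t. s t * (f t + f' t)) = (\<lambda>t. s t * f t + s t * f' t)"
    by (simp add: algebra_simps)
  then show ?thesis
    using assms by (simp add: exchange_defect_def add_left add_right continuous_on_mult)
qed

lemma exchange_defect_const:
  assumes "cont f"
  shows "exchange_defect (\<lambda>_. c) f = 0"
  using assms scale_left[of f "\<lambda>_. 1" c] scale_right[of f "\<lambda>_. 1" c] by (simp add: exchange_defect_def)

text \<open>Splitting \<open>1 = r + (1 - r)\<close> in the other argument turns both terms of the defect into \<open>\<psi> (r f) r\<close>;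
  the remaining terms pair functions with product zero.\<close>

lemma exchange_defect_two_valued:
  assumes r: "cont r" and f: "cont f" and *: "\<And>t. t \<in> {-1..1} \<Longrightarrow> r t * (1 - r t) * f t = 0"
  shows "exchange_defect r f = 0"
proof -
  have r': "cont (\<lambda>t. 1 - r t)" using r by (intro continuous_intros)
  have rf: "cont (\<lambda>t. r t * f t)" and rf': "cont (\<lambda>t. (1 - r t) * f t)"
    using r r' f by (auto intro: continuous_on_mult)
  have "\<psi> (\<lambda>t. r t * f t) (\<lambda>t. r t + (1 - r t))
      = \<psi> (\<lambda>t. r t * f t) r + \<psi> (\<lambda>t. r t * f t) (\<lambda>t. 1 - r t)"
    by (rule add_right[OF rf r r'])
  moreover have "\<psi> (\<lambda>t. r t * f t) (\<lambda>t. 1 - r t) = 0"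
    using * by (intro orthogonal[OF rf r']) (simp add: mult.commute mult.left_commute)
  moreover have "\<psi> (\<lambda>t. r t * f t + (1 - r t) * f t) r
      = \<psi> (\<lambda>t. r t * f t) r + \<psi> (\<lambda>t. (1 - r t) * f t) r"
    by (rule add_left[OF rf rf' r])
  moreover have "\<psi> (\<lambda>t. (1 - r t) * f t) r = 0"
    using * by (intro orthogonal[OF rf' r]) (simp add: mult.commute mult.left_commute)
  moreover have "(\<lambda>t. r t * f t + (1 - r t) * f t) = f" by (simp add: algebra_simps)
  ultimately show ?thesis by (simp add: exchange_defect_def)
qed

lemma norm_exchange_defect_le:
  assumes "cont s" "cont f" "\<And>t. t \<in> {-1..1} \<Longrightarrow> \<bar>s t\<bar> \<le> M" "\<And>t. t \<in> {-1..1} \<Longrightarrow> \<bar>f t\<bar> \<le> 1"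
  shows "norm (exchange_defect s f) \<le> 2 * C * M"
proof -
  have "norm (\<psi> (\<lambda>t. s t * f t) (\<lambda>_. 1)) \<le> C * (M * 1) * 1"
  proof (intro bound continuous_on_mult assms(1,2))
    show "\<bar>s t * f t\<bar> \<le> M * 1" if "t \<in> {-1..1}" for t
      unfolding abs_mult using assms(3,4)[OF that] by (intro mult_mono) auto
  qed auto
  moreover have "norm (\<psi> f s) \<le> C * 1 * M"
    using assms by (intro bound) auto
  ultimately show ?thesis
    unfolding exchange_defect_def by (intro order_trans[OF norm_triangle_ineq4]) simp
qed

lemma exchange_defect_sum:
  assumes "\<And>m. cont (r m)" "cont f" "\<And>m. exchange_defect (r m) f = 0"
  shows "exchange_defect (\<lambda>t. \<Sum>m<(K::nat). r m t) f = 0"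
proof (induction K)
  case 0
  then show ?case using exchange_defect_const[OF assms(2), of 0] by simp
next
  case (Suc K)
  have "cont (\<lambda>t. \<Sum>m<K. r m t)" by (intro continuous_on_sum assms)
  then show ?case using Suc exchange_defect_add[OF _ assms(1,2)] assms(3) by simp
qed

text \<open>The cut-off function vanishes where the staircase rises, so all ramps can be exchanged, and the
  staircase is within 2 of \<open>N t + c\<close>.\<close>

lemma norm_exchange_defect_id_le:
  assumes c: "real N \<le> c"
  shows "real N * norm (exchange_defect (\<lambda>t. t) (\<lambda>t. clamp01 (1/2 - cos (2 * pi * (real N * t + c))))) \<le> 4 * C"
proof -
  define f where "f t = clamp01 (1/2 - cos (2 * pi * (real N * t + c)))" for t
  define r where "r m t = clamp01 (1/2 + 3 * (real N * t + c - real m))" for m :: nat and t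
  \<comment> \<open>Enough steps for all values of \<open>N t + c\<close>, which are nonnegative as \<open>c \<ge> N\<close>.\<close>
  define K where "K = nat \<lceil>real N + c + 1\<rceil>"
  define S where "S t = (\<Sum>m<K. r m t)" for t
  have cf: "cont f" and cr: "cont (r m)" for m
    unfolding f_def r_def by (intro cont_clamp01 continuous_intros)+
  then have cS: "cont S" unfolding S_def by (intro continuous_on_sum)
  have "r m t * (1 - r m t) * f t = 0" for m t
    using staircase_cos[of "real N * t + c" m] by (auto simp: r_def f_def)
  then have "exchange_defect (r m) f = 0" for m
    by (intro exchange_defect_two_valued cf cr)
  then have S0: "exchange_defect S f = 0"
    unfolding S_def by (intro exchange_defect_sum cf cr)
  have ct: "cont (\<lambda>t. real N * t)" "cont (\<lambda>_. c)" "cont (\<lambda>t. (-1) * S t)" "cont (\<lambda>t. t)"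
    using cS by (intro continuous_intros; simp)+
  have "\<bar>real N * t + c + (-1) * S t\<bar> \<le> 2" if "t \<in> {-1..1}" for t
  proof -
    have "\<bar>real N * t\<bar> \<le> real N" using that by (simp add: abs_mult mult_left_le abs_le_iff)
    moreover have "real N + c + 1 \<le> real K" unfolding K_def by linarith
    ultimately show ?thesis
      using staircase_approx[of "real N * t + c" K] c
      by (simp add: S_def r_def abs_minus_commute)
  qed
  then have "norm (exchange_defect (\<lambda>t. real N * t + c + (-1) * S t) f) \<le> 2 * C * 2"
    by (intro norm_exchange_defect_le cf continuous_on_add ct) (auto simp: f_def clamp01_bounds)
  moreover have "exchange_defect (\<lambda>t. real N * t + c + (-1) * S t) f = real N *\<^sub>R exchange_defect (\<lambda>t. t) f"
    by (simp only: exchange_defect_add[OF continuous_on_add[OF ct(1,2)] ct(3) cf] exchange_defect_add[OF ct(1,2) cf]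
        exchange_defect_scale[OF ct(4) cf] exchange_defect_scale[OF cS cf] exchange_defect_const[OF cf] S0) simp
  ultimately show ?thesis by (simp add: f_def[abs_def])
qed

text \<open>Two cut-off functions that are half a period apart add up to 1. So the defect of the identity is at
  most \<open>8 C / N\<close> for every \<open>N\<close>.\<close>

theorem orthogonal_form_id:
  "\<psi> (\<lambda>t. t) (\<lambda>_. 1) = \<psi> (\<lambda>_. 1) (\<lambda>t. t)"
proof -
  have "real N * norm (exchange_defect (\<lambda>t. t) (\<lambda>_. 1)) \<le> 8 * C" for N :: nat
  proof -
    define f where "f c t = clamp01 (1/2 - cos (2 * pi * (real N * t + c)))" for c t
    have shift: "cos (2 * pi * (real N * t + (real N + 1/2))) = - cos (2 * pi * (real N * t + real N))" for t
      using cos_periodic_pi[of "2 * pi * (real N * t + real N)"] by (simp add: algebra_simps)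
    have cf: "cont (f c)" for c
      unfolding f_def by (intro cont_clamp01 continuous_intros)
    have "(\<lambda>_. 1) = (\<lambda>t. f (real N) t + f (real N + 1/2) t)"
      by (auto simp: f_def shift clamp01_def max_def min_def)
    then have "exchange_defect (\<lambda>t. t) (\<lambda>_. 1) = exchange_defect (\<lambda>t. t) (f (real N)) + exchange_defect (\<lambda>t. t) (f (real N + 1/2))"
      using exchange_defect_add_right[OF continuous_on_id cf cf, of "real N" "real N + 1/2"] by (simp add: id_def)
    then have "real N * norm (exchange_defect (\<lambda>t. t) (\<lambda>_. 1))
      \<le> real N * norm (exchange_defect (\<lambda>t. t) (f (real N))) + real N * norm (exchange_defect (\<lambda>t. t) (f (real N + 1/2)))"
      by (simp add: norm_triangle_ineq mult_left_mono flip: distrib_left)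
    then show ?thesis
      using norm_exchange_defect_id_le[of N "real N"] norm_exchange_defect_id_le[of N "real N + 1/2"]
      by (simp add: f_def[abs_def])
  qed
  then have "norm (exchange_defect (\<lambda>t. t) (\<lambda>_. 1)) \<le> 0"
    using reals_Archimedean3 by (metis not_less zero_less_norm_iff linorder_not_le)
  then show ?thesis by (simp add: exchange_defect_def)
qed

end

lemma orthogonal_form_balanced_self_adjoint:
  fixes B :: "'a::cstar_algebra \<Rightarrow> 'a \<Rightarrow> 'b::real_normed_vector"
  assumes B: "bounded_bilinear B" and orth: "\<And>a b. a\<^sup>\<star> * b = 0 \<Longrightarrow> B a b = 0"
    and h: "h\<^sup>\<star> = h"
  shows "B (h * a) b = B a (h * b)"
proof -
  interpret bounded_bilinear B by (rule B)
  have small: "B (k * a) b = B a (k * b)" if k: "k\<^sup>\<star> = k" "norm k < 1" for k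
  proof -
    obtain C where C: "0 \<le> C" "\<And>x y. norm (B x y) \<le> norm x * norm y * C"
      using nonneg_bounded by blast
    have "B (cont_mult k (\<lambda>t. t) a) (cont_mult k (\<lambda>_. 1) b)
      = B (cont_mult k (\<lambda>_. 1) a) (cont_mult k (\<lambda>t. t) b)"
    proof (rule orthogonal_form_id[where C = "norm a * norm b * C"])
      fix f g :: "real \<Rightarrow> real" and M N
      assume f: "cont f" and g: "cont g"
      { assume "\<And>t. t \<in> {-1..1} \<Longrightarrow> f t * g t = 0"
        then have "norm (cont_mult k (\<lambda>t. f t * g t) b) \<le> 0 * norm b"
          using f g by (intro norm_cont_mult_le[OF k] continuous_on_mult) auto
        then show "B (cont_mult k f a) (cont_mult k g b) = 0"
          by (intro orth) (simp add: star_cont_mult[OF k f g]) }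
      { assume M: "\<And>t. t \<in> {-1..1} \<Longrightarrow> \<bar>f t\<bar> \<le> M" and N: "\<And>t. t \<in> {-1..1} \<Longrightarrow> \<bar>g t\<bar> \<le> N"
        have "0 \<le> M" using M[of 0] by simp
        have "norm (B (cont_mult k f a) (cont_mult k g b)) \<le> (M * norm a) * (N * norm b) * C"
          using C(1) \<open>0 \<le> M\<close>
          by (intro order_trans[OF C(2)] mult_right_mono mult_mono norm_cont_mult_le[OF k] f g M N) auto
        then show "norm (B (cont_mult k f a) (cont_mult k g b)) \<le> norm a * norm b * C * M * N"
          by (simp add: ac_simps) }
    qed (simp_all add: cont_mult_add[OF k] cont_mult_scale[OF k] add_left add_right
        scaleR_left scaleR_right)
    then show ?thesis by (simp add: cont_mult_one[OF k] cont_mult_id[OF k])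
  qed
  \<comment> \<open>The functional calculus is for norms less than 1.\<close>
  define r where "r = inverse (norm h + 1)"
  have nh: "0 < norm h + 1" by (rule add_nonneg_pos) auto
  then have r: "0 < r" by (simp add: r_def)
  have "norm (r *\<^sub>R h) < 1" using nh by (simp add: r_def field_simps)
  then have "B ((r *\<^sub>R h) * a) b = B a ((r *\<^sub>R h) * b)"
    by (intro small) (simp_all add: star_scaleR h)
  then show ?thesis using r by (simp add: scaleR_left scaleR_right)
qed

theorem orthogonal_form_balanced:
  fixes B :: "'a::cstar_algebra \<Rightarrow> 'a \<Rightarrow> 'b::complex_normed_vector"
  assumes B: "bounded_bilinear B" and orth: "\<And>a b. a\<^sup>\<star> * b = 0 \<Longrightarrow> B a b = 0"
    and conj: "\<And>c a b. B (c *\<^sub>C a) b = cnj c *\<^sub>C B a b"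
    and lin: "\<And>c a b. B a (c *\<^sub>C b) = c *\<^sub>C B a b"
  shows "B (c * a) b = B a (c\<^sup>\<star> * b)"
proof -
  interpret bounded_bilinear B by (rule B)
  define h k where "h = (1/2::complex) *\<^sub>C (c + c\<^sup>\<star>)" and "k = (- \<i>/2) *\<^sub>C (c - c\<^sup>\<star>)"
  have self: "h\<^sup>\<star> = h" "k\<^sup>\<star> = k"
    by (simp_all add: h_def k_def star_scaleC star_add star_diff star_star add.commute
        scaleC_diff_right scaleC_minus_left)
  have "\<i> *\<^sub>C k = (1/2) *\<^sub>C (c - c\<^sup>\<star>)" by (simp add: k_def scaleC_scaleC)
  then have "h + \<i> *\<^sub>C k = (1/2) *\<^sub>C (c + c)" "h - \<i> *\<^sub>C k = (1/2) *\<^sub>C (c\<^sup>\<star> + c\<^sup>\<star>)"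
    by (simp_all add: h_def flip: scaleC_add_right scaleC_diff_right)
  then have c: "c = h + \<i> *\<^sub>C k" "c\<^sup>\<star> = h - \<i> *\<^sub>C k"
    by (simp_all add: scaleC_add_right flip: scaleC_add_left)
  have "B (h * a) b = B a (h * b)" "B (k * a) b = B a (k * b)"
    by (rule orthogonal_form_balanced_self_adjoint[OF B orth]; simp add: self)+
  then show ?thesis
    by (subst c(1), subst c(2)) (simp add: distrib_right left_diff_distrib add_left add_right diff_right
        mult_scaleC_left conj lin scaleC_minus_left)
qed

section \<open>Approximate units\<close>

lemma eq_zero_if_mult_zero:
  fixes z :: "'a::cstar_algebra"
  assumes "\<And>y. z * y = 0"
  shows "z = 0"
  using norm_mult_star[of z] assms by simp

lemma norm_le_if_mult_le:
  fixes z :: "'a::cstar_algebra"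
  assumes "\<And>y. norm (z * y) \<le> c * norm y" "0 \<le> c"
  shows "norm z \<le> c"
proof (cases "z = 0")
  case True
  then show ?thesis using assms(2) by simp
next
  case False
  then show ?thesis
    using norm_mult_star[of z] assms(1)[of "z\<^sup>\<star>"] by (simp add: norm_star power2_eq_square)
qed

text \<open>Bernoulli's inequality gives \<open>(1 - t\<^sup>2) ^ n * (1 + n t\<^sup>2) \<le> (1 - t\<^sup>4) ^ n \<le> 1\<close>.\<close>

lemma power_one_minus_sq_bound:
  fixes t :: real
  assumes "\<bar>t\<bar> \<le> 1" "0 < d" "1 \<le> real n * d\<^sup>2"
  shows "\<bar>(1 - t\<^sup>2) ^ n * t\<bar> \<le> d"
proof -
  have t: "0 \<le> t\<^sup>2" "t\<^sup>2 \<le> 1" using assms(1) by (auto simp: abs_square_le_1)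
  define q where "q = (1 - t\<^sup>2) ^ n"
  have q: "0 \<le> q" "q \<le> 1" using t by (auto simp: q_def intro: power_le_one)
  have "q * (1 + real n * t\<^sup>2) \<le> q * (1 + t\<^sup>2) ^ n"
    using Bernoulli_inequality[of "t\<^sup>2" n] t q by (intro mult_left_mono) auto
  also have "\<dots> = (1 - t\<^sup>2 * t\<^sup>2) ^ n"
    by (simp add: q_def algebra_simps flip: power_mult_distrib)
  also have "\<dots> \<le> 1"
    using mult_le_one[OF t(2) t(1) t(2)] by (intro power_le_one) simp_all
  finally have "real n * (q * t\<^sup>2) \<le> 1" using q by (simp add: algebra_simps)
  also have "\<dots> \<le> real n * d\<^sup>2" by (rule assms)
  finally have "q * t\<^sup>2 \<le> d\<^sup>2" using assms by (cases "n = 0") auto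
  moreover have "q * (q * t\<^sup>2) \<le> 1 * (q * t\<^sup>2)" using q t by (intro mult_right_mono) auto
  ultimately have "(q * t)\<^sup>2 \<le> d\<^sup>2" by (simp add: power2_eq_square ac_simps)
  then show ?thesis
    using assms(2) by (simp add: q_def abs_le_square_iff[symmetric])
qed

text \<open>The unit for one element \<open>a\<close> comes from \<open>h = a a\<^sup>*\<close> through \<open>1 - e = (1 - h\<^sup>2) ^ n\<close>: this is
  a contraction, and \<open>\<parallel>a - e a\<parallel>\<^sup>2 \<le> \<parallel>h - e h\<parallel>\<close>, which is at most the maximum of
  \<open>\<bar>(1 - t\<^sup>2) ^ n * t\<bar>\<close>.\<close>

lemma approximate_unit_small:
  fixes a :: "'a::cstar_algebra"
  assumes a: "norm a < 1" and \<epsilon>: "0 < \<epsilon>"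
  shows "\<exists>e w. e = a * w \<and> e\<^sup>\<star> = e \<and> (\<forall>x. norm (x - e * x) \<le> norm x) \<and> norm (a - e * a) < \<epsilon>"
proof -
  define h where "h = a * a\<^sup>\<star>"
  have "(norm a)\<^sup>2 < 1" using a by (simp add: power_less_one_iff abs_square_less_1)
  then have h: "h\<^sup>\<star> = h" "norm h < 1"
    by (simp_all add: h_def star_mult star_star norm_mult_star)
  define d where "d = (\<epsilon> / 2)\<^sup>2"
  have d: "0 < d" using \<epsilon> by (simp add: d_def)
  obtain n where n: "1 \<le> real n * d\<^sup>2"
    using reals_Archimedean3[of "d\<^sup>2"] d by (metis less_imp_le zero_less_power)
  \<comment> \<open>\<open>p = (1 - t\<^sup>2) ^ n\<close> has constant term 1, so that \<open>1 - p(h)\<close> is multiplication by an element.\<close>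
  define p where "p = [:1, 0, - 1 :: real:] ^ n"
  have poly_p: "poly p t = (1 - t\<^sup>2) ^ n" for t
    by (simp add: p_def poly_power power2_eq_square)
  obtain c q where p: "p = pCons c q" by (cases p)
  have "c = 1" using poly_p[of 0] by (simp add: p)
  define e where "e = - poly_mult h q h"
  have ex: "e * x = - (h * poly_mult h q x)" for x
    by (simp add: e_def poly_mult_times[symmetric] poly_mult_self)
  have px: "poly_mult h p x = x - e * x" for x
    by (simp add: p \<open>c = 1\<close> ex)
  have "(e\<^sup>\<star> - e) * y = 0" for y
  proof -
    have "(poly_mult h q h)\<^sup>\<star> * y = poly_mult h q h * y"
      by (simp add: star_poly_mult[OF h(1)] h(1) poly_mult_times[symmetric] poly_mult_self)
    then show ?thesis by (simp add: e_def star_minus algebra_simps)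
  qed
  then have e: "e\<^sup>\<star> = e" using eq_zero_if_mult_zero[of "e\<^sup>\<star> - e"] by simp
  have "e = (- (poly_mult h q a * a\<^sup>\<star>))\<^sup>\<star>"
    unfolding poly_mult_times[symmetric] h_def[symmetric] e_def[symmetric] by (simp add: e)
  then have aw: "e = a * (- (poly_mult h q a)\<^sup>\<star>)"
    by (simp add: star_minus star_mult star_star)
  have contr: "norm (x - e * x) \<le> norm x" for x
  proof -
    have "\<bar>poly p t\<bar> \<le> 1" if "\<bar>t\<bar> \<le> 1" for t
    proof -
      have "t\<^sup>2 \<le> 1" using that by (simp add: abs_square_le_1)
      then have "\<bar>1 - t\<^sup>2\<bar> \<le> 1" by (simp add: abs_le_iff)
      then show ?thesis unfolding poly_p power_abs by (intro power_le_one) auto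
    qed
    from norm_poly_mult_le[OF h this, of x] show ?thesis by (simp add: px)
  qed
  define z where "z = h - e * h"
  have "norm (z * x) \<le> d * norm x" for x
  proof -
    have "z * x = poly_mult h (p * [:0, 1:]) x"
      by (simp only: poly_mult_mult px) (simp add: z_def algebra_simps)
    moreover have "norm (poly_mult h (p * [:0, 1:]) x) \<le> d * norm x"
      by (rule norm_poly_mult_le[OF h])
        (use power_one_minus_sq_bound[OF _ d n] in \<open>simp only: poly_mult poly_p, simp\<close>)
    ultimately show ?thesis by simp
  qed
  then have z: "norm z \<le> d" by (rule norm_le_if_mult_le) (use d in simp)
  define y where "y = a - e * a"
  have "y * y\<^sup>\<star> = z - z * e"
    by (simp add: y_def z_def h_def star_diff star_mult e algebra_simps)
  then have "(norm y)\<^sup>2 = norm ((z - z * e)\<^sup>\<star>)"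
    by (simp add: norm_star flip: norm_mult_star)
  also have "\<dots> \<le> norm z"
    using contr[of "z\<^sup>\<star>"] by (simp add: star_diff star_mult e norm_star)
  also have "\<dots> \<le> (\<epsilon> / 2)\<^sup>2" using z by (simp add: d_def)
  finally have "norm y \<le> \<epsilon> / 2" using \<epsilon> by (intro power2_le_imp_le[of "norm y"]) auto
  then have "norm (a - e * a) < \<epsilon>" using \<epsilon> by (simp add: y_def)
  with aw e contr show ?thesis by blast
qed

lemma approximate_unit_single:
  fixes a :: "'a::cstar_algebra"
  assumes \<epsilon>: "0 < \<epsilon>"
  shows "\<exists>e w. e = a * w \<and> e\<^sup>\<star> = e \<and> (\<forall>x. norm (x - e * x) \<le> norm x) \<and> norm (a - e * a) < \<epsilon>"
proof -
  define r where "r = inverse (norm a + 1)"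
  have "0 < norm a + 1" by (rule add_nonneg_pos) auto
  then have r: "0 < r" "norm (r *\<^sub>R a) < 1" by (simp_all add: r_def field_simps)
  obtain e w where e: "e = r *\<^sub>R a * w" "e\<^sup>\<star> = e" "\<forall>x. norm (x - e * x) \<le> norm x"
    "norm (r *\<^sub>R a - e * (r *\<^sub>R a)) < r * \<epsilon>"
    using approximate_unit_small[OF r(2), of "r * \<epsilon>"] r(1) \<epsilon> by auto
  have "r *\<^sub>R a - e * (r *\<^sub>R a) = r *\<^sub>R (a - e * a)" by (simp add: algebra_simps)
  then have "norm (a - e * a) < \<epsilon>" using e(4) r(1) by simp
  moreover have "e = a * (r *\<^sub>R w)" using e(1) by simp
  ultimately show ?thesis using e(2,3) by blast
qed

lemma approximately_regular:
  fixes a :: "'a::cstar_algebra"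
  assumes "0 < \<epsilon>"
  shows "\<exists>w. norm (a - a * w * a) < \<epsilon>"
  using approximate_unit_single[OF assms, of a] by blast

text \<open>For finitely many elements one multiplies the contractions \<open>1 - e\<close>, each new factor being
  chosen for what the previous ones have left of the next element.\<close>

lemma approximate_unit_finite:
  fixes X :: "'a::cstar_algebra set"
  assumes "finite X" and \<epsilon>: "0 < \<epsilon>"
  shows "\<exists>e. (\<forall>x. norm (x - e * x) \<le> norm x) \<and> (\<forall>a\<in>X. norm (a - e * a) < \<epsilon>)"
  using assms(1)
proof induction
  case empty
  show ?case by (intro exI[of _ 0]) simp
next
  case (insert a X)
  then obtain e where e: "\<And>x. norm (x - e * x) \<le> norm x" "\<And>x. x \<in> X \<Longrightarrow> norm (x - e * x) < \<epsilon>"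
    by blast
  obtain e' where e': "\<And>x. norm (x - e' * x) \<le> norm x"
    "norm ((a - e * a) - e' * (a - e * a)) < \<epsilon>"
    using approximate_unit_single[OF \<epsilon>, of "a - e * a"] by blast
  define f where "f = e + e' - e' * e"
  have f: "x - f * x = (x - e * x) - e' * (x - e * x)" for x
    by (simp add: f_def algebra_simps)
  have "norm (x - f * x) \<le> norm x" for x
    unfolding f using e'(1)[of "x - e * x"] e(1)[of x] by linarith
  moreover have "norm (x - f * x) < \<epsilon>" if "x \<in> insert a X" for x
    using that e'(2) e'(1)[of "x - e * x"] e(2)[of x] unfolding f by fastforce
  ultimately show ?case by blast
qed

text \<open>The contraction \<open>1 - e\<close> is replaced by \<open>(1 - e\<^sup>*) (1 - e)\<close>.\<close>

lemma approximate_unit_self_adjoint: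
  fixes X :: "'a::cstar_algebra set"
  assumes "finite X" and \<epsilon>: "0 < \<epsilon>"
  shows "\<exists>e. e\<^sup>\<star> = e \<and> (\<forall>x. norm (x - e * x) \<le> norm x) \<and> (\<forall>a\<in>X. norm (a - e * a) < \<epsilon>)"
proof -
  obtain e where e: "\<And>x. norm (x - e * x) \<le> norm x" "\<And>x. x \<in> X \<Longrightarrow> norm (x - e * x) < \<epsilon>"
    using approximate_unit_finite[OF assms] by blast
  have adj: "norm (x - e\<^sup>\<star> * x) \<le> norm x" for x
  proof -
    define y where "y = x - e\<^sup>\<star> * x"
    have "y\<^sup>\<star> * y = x\<^sup>\<star> * (y - e * y)"
      by (simp add: y_def star_diff star_mult star_star algebra_simps)
    then have "norm y * norm y \<le> norm x * norm (y - e * y)"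
      using norm_mult_ineq[of "x\<^sup>\<star>" "y - e * y"]
        cstar_identity[of y]
      by (simp add: norm_star power2_eq_square)
    also have "\<dots> \<le> norm x * norm y" by (intro mult_left_mono e) simp
    finally show ?thesis unfolding y_def[symmetric] by (cases "y = 0") auto
  qed
  define f where "f = e + e\<^sup>\<star> - e\<^sup>\<star> * e"
  have f: "x - f * x = (x - e * x) - e\<^sup>\<star> * (x - e * x)" for x
    by (simp add: f_def algebra_simps)
  have "f\<^sup>\<star> = f" by (simp add: f_def star_add star_diff star_mult star_star add.commute)
  moreover have le: "norm (x - f * x) \<le> norm (x - e * x)" for x
    unfolding f by (rule adj)
  ultimately show ?thesis
    using e by (meson order_trans order_le_less_trans)
qed

text \<open>A filter on the algebra takes the place of a net.\<close>

locale approximate_unit =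
  fixes F :: "'a::cstar_algebra filter"
  assumes proper: "F \<noteq> bot"
    and self_adjoint: "\<forall>\<^sub>F e in F. e\<^sup>\<star> = e"
    and contraction: "\<forall>\<^sub>F e in F. \<forall>x. norm (x - e * x) \<le> norm x"
    and tendsto_left: "((\<lambda>e. e * a) \<longlongrightarrow> a) F"

text \<open>An error below 1 on every finite set is enough: if the set contains \<open>a / \<epsilon>\<close>, then the error at \<open>a\<close>
  is below \<open>\<epsilon>\<close>.\<close>

theorem approximate_unit_exists: "\<exists>F :: 'a::cstar_algebra filter. approximate_unit F"
proof -
  obtain E :: "'a set \<Rightarrow> 'a" where E: "\<And>X. finite X \<Longrightarrow> (E X)\<^sup>\<star> = E X"
    "\<And>X x. finite X \<Longrightarrow> norm (x - E X * x) \<le> norm x"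
    "\<And>X a. finite X \<Longrightarrow> a \<in> X \<Longrightarrow> norm (a - E X * a) < 1"
    using approximate_unit_self_adjoint[OF _ zero_less_one] by metis
  let ?F = "filtermap E (finite_subsets_at_top UNIV)"
  have fin: "\<forall>\<^sub>F X in finite_subsets_at_top (UNIV :: 'a set). finite X"
    by (auto simp: eventually_finite_subsets_at_top)
  have "approximate_unit ?F"
  proof
    show "?F \<noteq> bot" by (simp add: filtermap_bot_iff)
    show "\<forall>\<^sub>F e in ?F. e\<^sup>\<star> = e" "\<forall>\<^sub>F e in ?F. \<forall>x. norm (x - e * x) \<le> norm x"
      unfolding eventually_filtermap using fin by (eventually_elim, simp add: E)+
    fix a :: 'a
    have "\<forall>\<^sub>F X in finite_subsets_at_top UNIV. dist (E X * a) a < \<epsilon>" if "0 < \<epsilon>" for \<epsilon>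
    proof -
      have "dist (E X * a) a < \<epsilon>" if "finite X" "inverse \<epsilon> *\<^sub>R a \<in> X" for X
      proof -
        have "inverse \<epsilon> *\<^sub>R a - E X * (inverse \<epsilon> *\<^sub>R a) = inverse \<epsilon> *\<^sub>R (a - E X * a)"
          by (simp add: algebra_simps)
        then have "norm (inverse \<epsilon> *\<^sub>R (a - E X * a)) < 1"
          using E(3)[OF that] by simp
        then have "norm (a - E X * a) / \<epsilon> < 1"
          using \<open>0 < \<epsilon>\<close> by (simp add: divide_inverse mult.commute)
        then show ?thesis
          using \<open>0 < \<epsilon>\<close> by (simp add: dist_norm norm_minus_commute)
      qed
      then show ?thesis
        unfolding eventually_finite_subsets_at_top
        by (intro exI[of _ "{inverse \<epsilon> *\<^sub>R a}"]) auto
    qed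
    then show "((\<lambda>e. e * a) \<longlongrightarrow> a) ?F"
      unfolding filterlim_filtermap by (intro tendstoI) auto
  qed
  then show ?thesis by blast
qed

section \<open>Approximate units act as a unit on the bidual\<close>

lemma cnj_sgn_mult: "cnj (sgn z) * z = of_real (cmod z)"
proof (cases "z = 0")
  case False
  have "cnj z * z = of_real (cmod z) * of_real (cmod z)"
    using complex_norm_square[of z] by (simp add: power2_eq_square mult.commute)
  moreover have "cnj (sgn z) * z = cnj z * z / of_real (cmod z)"
    unfolding sgn_eq by simp
  ultimately show ?thesis using False by simp
qed simp

lemma cmod_cnj_sgn_le: "cmod (cnj (sgn z)) \<le> 1"
  by (simp add: norm_sgn)

lemma near_norming_element:
  assumes "0 < \<kappa>"
  obtains a where "norm a \<le> 1" "apply_dual f a = of_real (cmod (apply_dual f a))"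
    "norm f - \<kappa> \<le> cmod (apply_dual f a)"
proof -
  have "\<exists>a. norm a \<le> 1 \<and> norm f - \<kappa> \<le> cmod (apply_dual f a)"
  proof (cases "norm f \<le> \<kappa>")
    case True
    then show ?thesis by (intro exI[of _ 0]) simp
  next
    case False
    have "\<not> (\<forall>x. cmod (apply_dual f x) \<le> (norm f - \<kappa>) * norm x)"
      using norm_cdual_bound[of "norm f - \<kappa>" f] False assms by auto
    then obtain x where x: "(norm f - \<kappa>) * norm x < cmod (apply_dual f x)"
      by (auto simp: not_le)
    then have "x \<noteq> 0" by auto
    define y where "y = of_real (inverse (norm x)) *\<^sub>C x"
    have "norm y = 1" using \<open>x \<noteq> 0\<close> by (simp add: y_def norm_scaleC norm_inverse)
    moreover have "norm f - \<kappa> \<le> cmod (apply_dual f y)"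
    proof -
      have "cmod (apply_dual f y) = cmod (apply_dual f x) / norm x"
        by (simp only: y_def apply_dual_scaleC norm_mult norm_of_real) (simp add: field_simps)
      then show ?thesis using x \<open>x \<noteq> 0\<close> by (simp add: pos_le_divide_eq)
    qed
    ultimately show ?thesis by (intro exI[of _ y]) simp
  qed
  then obtain a where a: "norm a \<le> 1" "norm f - \<kappa> \<le> cmod (apply_dual f a)" by blast
  let ?b = "cnj (sgn (apply_dual f a)) *\<^sub>C a"
  have fb: "apply_dual f ?b = of_real (cmod (apply_dual f a))"
    by (simp only: apply_dual_scaleC cnj_sgn_mult)
  have "norm ?b \<le> 1"
    unfolding norm_scaleC using a(1) cmod_cnj_sgn_le by (intro mult_le_one) auto
  with fb a(2) that show thesis by simp
qed

text \<open>If \<open>f\<close> nearly attains its norm at \<open>a\<close> and \<open>c = b - e b\<close> is almost orthogonal to \<open>a\<close>, then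
  \<open>\<parallel>a + \<delta> c\<parallel>\<^sup>2\<close> is about \<open>1 + \<delta>\<^sup>2\<close>, so a value of \<open>f\<close> at \<open>c\<close> that is not small against \<open>\<delta>\<close>
  would push \<open>f\<close> beyond its norm.\<close>

lemma norm_dual_mult_diff_le:
  fixes f :: "'a::cstar_algebra cdual"
  assumes \<delta>: "0 < \<delta>"
    and a: "norm a \<le> 1" "apply_dual f a = of_real (cmod (apply_dual f a))"
      "norm f - \<delta>\<^sup>2 \<le> cmod (apply_dual f a)"
    and e: "e\<^sup>\<star> = e" "\<And>x. norm (x - e * x) \<le> norm x" "norm (a - e * a) \<le> \<delta>"
  shows "norm (f - dual_mult f e) \<le> (2 * norm f + 1) * \<delta>"
proof (rule norm_cdual_bound)
  have unit_ball: "cmod (apply_dual f (b - e * b)) \<le> (2 * norm f + 1) * \<delta>" if b: "norm b \<le> 1" for b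
  proof -
    define v where "v = cmod (apply_dual f (b - e * b))"
    \<comment> \<open>The phase makes \<open>f (c - e c)\<close> nonnegative, so that it adds to \<open>f a\<close> without cancellation.\<close>
    define c where "c = cnj (sgn (apply_dual f (b - e * b))) *\<^sub>C b"
    have c1: "norm c \<le> 1"
      unfolding c_def norm_scaleC using b cmod_cnj_sgn_le by (intro mult_le_one) auto
    have ce: "c - e * c = cnj (sgn (apply_dual f (b - e * b))) *\<^sub>C (b - e * b)"
      by (simp add: c_def mult_scaleC_right scaleC_diff_right)
    have fc: "apply_dual f (c - e * c) = of_real v"
      by (simp only: ce apply_dual_scaleC cnj_sgn_mult v_def)
    define x where "x = a + \<delta> *\<^sub>R (c - e * c)"
    have ca: "(c - e * c)\<^sup>\<star> * a = c\<^sup>\<star> * (a - e * a)"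
      by (simp add: star_diff star_mult e(1) algebra_simps)
    then have ca_le: "norm ((c - e * c)\<^sup>\<star> * a) \<le> \<delta>"
      using order_trans[OF norm_mult_ineq[of "c\<^sup>\<star>" "a - e * a"] mult_mono[OF _ e(3), of "norm (c\<^sup>\<star>)" 1]] c1
      by (simp add: norm_star)
    have "a\<^sup>\<star> * (c - e * c) = ((c - e * c)\<^sup>\<star> * a)\<^sup>\<star>" by (simp add: star_mult star_star)
    then have ac_le: "norm (a\<^sup>\<star> * (c - e * c)) \<le> \<delta>" using ca_le by (simp only: norm_star)
    have cc_le: "norm ((c - e * c)\<^sup>\<star> * (c - e * c)) \<le> 1"
      using e(2)[of c] c1 by (simp add: cstar_identity power_le_one)
    have "x\<^sup>\<star> * x = a\<^sup>\<star> * a + \<delta> *\<^sub>R (a\<^sup>\<star> * (c - e * c)) + \<delta> *\<^sub>R ((c - e * c)\<^sup>\<star> * a)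
        + (\<delta> * \<delta>) *\<^sub>R ((c - e * c)\<^sup>\<star> * (c - e * c))"
      by (simp add: x_def star_add star_scaleR distrib_left distrib_right scaleR_add_right)
    then have "(norm x)\<^sup>2 \<le> norm (a\<^sup>\<star> * a) + norm (\<delta> *\<^sub>R (a\<^sup>\<star> * (c - e * c)))
        + norm (\<delta> *\<^sub>R ((c - e * c)\<^sup>\<star> * a)) + norm ((\<delta> * \<delta>) *\<^sub>R ((c - e * c)\<^sup>\<star> * (c - e * c)))"
      unfolding cstar_identity[of x, symmetric] by (metis norm_add_rule_thm order_refl norm_triangle_le)
    also have "\<dots> \<le> 1 + \<delta> * \<delta> + \<delta> * \<delta> + (\<delta> * \<delta>) * 1"
      using \<delta> a(1) ac_le ca_le cc_le
      by (intro add_mono) (auto simp: cstar_identity power_le_one mult_left_mono)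
    also have "\<dots> \<le> (1 + 2 * \<delta>\<^sup>2)\<^sup>2"
      using \<delta> by (auto simp: power2_eq_square algebra_simps intro!: add_nonneg_nonneg mult_nonneg_nonneg)
    finally have x: "norm x \<le> 1 + 2 * \<delta>\<^sup>2" by (rule power2_le_imp_le) simp
    have "apply_dual f x = of_real (cmod (apply_dual f a) + \<delta> * v)"
      by (simp add: x_def scaleR_scaleC fc del: apply_dual_diff) (metis a(2))
    then have "cmod (apply_dual f a) + \<delta> * v = cmod (apply_dual f x)"
      using \<delta> by (simp add: v_def norm_of_real del: of_real_add)
    also have "\<dots> \<le> norm f * (1 + 2 * \<delta>\<^sup>2)"
      by (intro order_trans[OF norm_apply_dual] mult_left_mono x) simp
    finally have "\<delta> * v \<le> \<delta> * ((2 * norm f + 1) * \<delta>)"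
      using a(3) by (simp add: algebra_simps power2_eq_square)
    then show ?thesis using \<delta> by (simp add: v_def)
  qed
  fix b
  show "cmod (apply_dual (f - dual_mult f e) b) \<le> (2 * norm f + 1) * \<delta> * norm b"
  proof (cases "b = 0")
    case False
    define c where "c = of_real (inverse (norm b)) *\<^sub>C b"
    have "norm c = 1" using False by (simp add: c_def norm_scaleC norm_inverse)
    moreover have "b = of_real (norm b) *\<^sub>C c"
      using False by (simp add: c_def scaleC_scaleC flip: of_real_mult)
    then have "b - e * b = of_real (norm b) *\<^sub>C (c - e * c)"
      by (metis mult_scaleC_right scaleC_diff_right)
    then have "cmod (apply_dual f (b - e * b)) = norm b * cmod (apply_dual f (c - e * c))"
      by (simp only: apply_dual_scaleC norm_mult norm_of_real abs_norm_cancel)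
    ultimately show ?thesis
      using mult_left_mono[OF unit_ball[of c], of "norm b"] by (simp add: ac_simps)
  qed simp
qed (use \<delta> in simp)

context approximate_unit
begin

lemma tendsto_right: "((\<lambda>e. a * e) \<longlongrightarrow> a) F"
proof -
  have "((\<lambda>e. (e * a\<^sup>\<star>)\<^sup>\<star>) \<longlongrightarrow> (a\<^sup>\<star>)\<^sup>\<star>) F"
    by (intro tendsto_star tendsto_left)
  moreover have "\<forall>\<^sub>F e in F. (e * a\<^sup>\<star>)\<^sup>\<star> = a * e"
    using self_adjoint by eventually_elim (simp add: star_mult star_star)
  ultimately show ?thesis by (simp add: star_star tendsto_cong)
qed

lemma tendsto_dual_mult: "((\<lambda>e. dual_mult f e) \<longlongrightarrow> f) F"
proof (rule tendstoI)
  fix \<epsilon> :: real assume "0 < \<epsilon>"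
  define K \<delta> where "K = 2 * norm f + 1" and "\<delta> = \<epsilon> / (2 * K)"
  have "0 < K" unfolding K_def by (rule add_nonneg_pos) auto
  then have \<delta>: "0 < \<delta>" "(2 * norm f + 1) * \<delta> < \<epsilon>"
    using \<open>0 < \<epsilon>\<close> by (simp_all add: \<delta>_def flip: K_def)
  obtain a where a: "norm a \<le> 1" "apply_dual f a = of_real (cmod (apply_dual f a))"
      "norm f - \<delta>\<^sup>2 \<le> cmod (apply_dual f a)"
    using near_norming_element[of "\<delta>\<^sup>2" f] \<delta>(1) by auto
  show "\<forall>\<^sub>F e in F. dist (dual_mult f e) f < \<epsilon>"
    using self_adjoint contraction tendstoD[OF tendsto_left[of a] \<delta>(1)]
  proof eventually_elim
    case (elim e)
    have "norm (a - e * a) \<le> \<delta>" using elim(3) by (simp add: dist_norm norm_minus_commute)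
    then have "norm (f - dual_mult f e) \<le> (2 * norm f + 1) * \<delta>"
      using elim(1,2) by (intro norm_dual_mult_diff_le[OF \<delta>(1) a]) auto
    then show ?case using \<delta>(2) by (simp add: dist_norm norm_minus_commute)
  qed
qed

lemma tendsto_left_bidual: "((\<lambda>e. apply_dual (\<iota> e \<odot> m) f) \<longlongrightarrow> apply_dual m f) F"
  using bounded_linear.tendsto[OF apply_dual_bounded_linear tendsto_dual_mult]
  by (simp add: apply_bidual_mult)

lemma tendsto_right_bidual: "((\<lambda>e. apply_dual (m \<odot> \<iota> e) f) \<longlongrightarrow> apply_dual m f) F"
proof -
  have "((\<lambda>e. cnj (apply_dual (\<iota> e \<odot> m\<^sup>\<bullet>) (dual_star f))) \<longlongrightarrow> cnj (apply_dual (m\<^sup>\<bullet>) (dual_star f))) F"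
    by (intro tendsto_intros tendsto_left_bidual)
  moreover have "\<forall>\<^sub>F e in F. cnj (apply_dual (\<iota> e \<odot> m\<^sup>\<bullet>) (dual_star f)) = apply_dual (m \<odot> \<iota> e) f"
    using self_adjoint
    by eventually_elim (simp add: bidual_star_to_bidual_mult bidual_star_star flip: apply_bidual_star)
  ultimately show ?thesis
    by (simp add: bidual_star_star tendsto_cong flip: apply_bidual_star)
qed

lemma eventually_norm_le: "\<forall>\<^sub>F e in F. norm e \<le> 2"
  using contraction
proof eventually_elim
  case (elim e)
  have "norm (e * x) \<le> 2 * norm x" for x
    using elim[rule_format, of x] norm_triangle_ineq4[of x "x - e * x"] by simp
  then show ?case by (rule norm_le_if_mult_le) simp
qed

text \<open>Fix \<open>u\<close> far along the filter. Then \<open>g e\<close> is close to \<open>g (u e)\<close>, uniformly in \<open>e\<close>, and \<open>g (u e)\<close>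
  converges to \<open>g u\<close>. So the values \<open>g e\<close> form a Cauchy filter.\<close>

lemma apply_dual_convergent: "\<exists>l. ((\<lambda>e. apply_dual g e) \<longlongrightarrow> l) F"
proof -
  have "\<exists>P. eventually P F \<and> (\<forall>x y. P x \<and> P y \<longrightarrow> dist (apply_dual g x) (apply_dual g y) < \<epsilon>)"
    if \<epsilon>: "0 < \<epsilon>" for \<epsilon>
  proof -
    have "\<forall>\<^sub>F e in F. dist (dual_mult g e) g < \<epsilon> / 8"
      using \<epsilon> by (intro tendstoD[OF tendsto_dual_mult]) simp
    from eventually_happens'[OF proper this]
    obtain u where u: "norm (g - dual_mult g u) < \<epsilon> / 8"
      by (auto simp: dist_norm norm_minus_commute)
    have "((\<lambda>e. apply_dual g (u * e)) \<longlongrightarrow> apply_dual g u) F"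
      by (intro bounded_linear.tendsto[OF apply_dual_bounded_linear] tendsto_right)
    then have "\<forall>\<^sub>F e in F. dist (apply_dual g (u * e)) (apply_dual g u) < \<epsilon> / 4"
      using \<epsilon> by (intro tendstoD) auto
    then have close: "\<forall>\<^sub>F e in F. dist (apply_dual g e) (apply_dual g u) < \<epsilon> / 2"
      using eventually_norm_le
    proof eventually_elim
      case (elim e)
      have "cmod (apply_dual (g - dual_mult g u) e) \<le> \<epsilon> / 8 * 2"
        using u elim(2) \<epsilon> by (intro order_trans[OF norm_apply_dual] mult_mono) auto
      then have "dist (apply_dual g e) (apply_dual g (u * e)) \<le> \<epsilon> / 4"
        by (simp add: dist_norm)
      then show ?case
        using elim(1) dist_triangle[of "apply_dual g e" "apply_dual g u" "apply_dual g (u * e)"]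
        by linarith
    qed
    show ?thesis
      using close by (intro exI[of _ "\<lambda>e. dist (apply_dual g e) (apply_dual g u) < \<epsilon> / 2"])
        (auto intro: dist_triangle_half_l)
  qed
  then have "cauchy_filter (filtermap (apply_dual g) F)"
    by (simp add: cauchy_filter_metric_filtermap)
  then obtain l where "filtermap (apply_dual g) F \<le> nhds l"
    using complete_UNIV[where 'a = complex] proper
    unfolding complete_uniform by (metis filtermap_bot_iff UNIV_I principal_UNIV top_greatest)
  then show ?thesis by (auto simp: filterlim_def)
qed

text \<open>The limit exists for every bounded \<open>T\<close> because each functional \<open>a \<mapsto> T a f\<close> converges along
  the approximate unit.\<close>

lemma weak_star_limit:
  fixes T :: "'a \<Rightarrow> 'b::complex_normed_vector cdual"
  assumes T: "bounded_clinear T"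
  obtains \<eta> where "\<And>f. ((\<lambda>e. apply_dual (T e) f) \<longlongrightarrow> apply_dual \<eta> f) F"
proof -
  obtain K where K: "\<And>x. norm (T x) \<le> K * norm x"
    using T by (auto simp: bounded_clinear_def)
  have add: "T (x + y) = T x + T y" and scale: "T (c *\<^sub>C x) = c *\<^sub>C T x" for x y c
    using T by (simp_all add: bounded_clinear_def clinear_iff)
  have lim_ex: "\<exists>l. ((\<lambda>e. apply_dual (T e) f) \<longlongrightarrow> l) F" for f
  proof -
    have "cmod (apply_dual (T x) f) \<le> K * norm f * norm x" for x
      using order_trans[OF norm_apply_dual mult_right_mono[OF K], of f x] by (simp add: ac_simps)
    then have "bounded_clinear (\<lambda>x. apply_dual (T x) f)"
      by (auto simp: bounded_clinear_def clinear_iff add scale scaleC_complex_def)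
    then have "apply_dual (Abs_dual (\<lambda>x. apply_dual (T x) f)) = (\<lambda>x. apply_dual (T x) f)"
      by (simp add: Abs_dual_inverse)
    then show ?thesis
      using apply_dual_convergent[of "Abs_dual (\<lambda>x. apply_dual (T x) f)"] by simp
  qed
  then obtain L where L: "\<And>f. ((\<lambda>e. apply_dual (T e) f) \<longlongrightarrow> L f) F" by metis
  have "L (f + g) = L f + L g" for f g
    using tendsto_add[OF L L, of f g] L[of "f + g"] by (simp add: tendsto_unique[OF proper])
  moreover have "L (c *\<^sub>C f) = c * L f" for c f
    using tendsto_mult_left[OF L, of c f] L[of "c *\<^sub>C f"] by (simp add: tendsto_unique[OF proper])
  moreover have "cmod (L f) \<le> \<bar>K\<bar> * 2 * norm f" for f
  proof (rule tendsto_upperbound[OF tendsto_norm[OF L] _ proper])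
    show "\<forall>\<^sub>F e in F. cmod (apply_dual (T e) f) \<le> \<bar>K\<bar> * 2 * norm f"
      using eventually_norm_le
    proof eventually_elim
      case (elim e)
      have "norm (T e) \<le> \<bar>K\<bar> * 2"
        by (rule order_trans[OF K]) (use elim in \<open>auto intro!: mult_mono\<close>)
      then show ?case
        by (intro order_trans[OF norm_apply_dual] mult_right_mono) auto
    qed
  qed
  ultimately have "bounded_clinear L"
    by (auto simp: bounded_clinear_def clinear_iff scaleC_complex_def)
  then have "apply_dual (Abs_dual L) = L" by (simp add: Abs_dual_inverse)
  with L that show thesis by metis
qed

end

section \<open>Twisted anti-derivations\<close>

lemma bounded_linear_mult_to_bidual: "bounded_linear (\<lambda>x. m \<odot> \<iota> x)"
proof (rule bounded_linear_intro[where K = "norm m"])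
  fix x :: 'a
  show "norm (m \<odot> \<iota> x) \<le> norm x * norm m"
    using norm_bidual_mult[of m "\<iota> x"] mult_left_mono[OF norm_to_bidual_le[of x] norm_ge_zero[of m]]
    by (simp add: mult.commute)
qed (simp_all only: to_bidual_add to_bidual_scaleC scaleR_scaleC bidual_mult_distrib)

lemma bounded_linear_to_bidual_mult: "bounded_linear (\<lambda>x. \<iota> x \<odot> m)"
proof (rule bounded_linear_intro[where K = "norm m"])
  fix x :: 'a
  show "norm (\<iota> x \<odot> m) \<le> norm x * norm m"
    using norm_bidual_mult[of "\<iota> x" m] mult_right_mono[OF norm_to_bidual_le[of x] norm_ge_zero[of m]]
    by simp
qed (simp_all only: to_bidual_add to_bidual_scaleC scaleR_scaleC bidual_mult_distrib)

text \<open>The elements \<open>u w u\<close> come arbitrarily close to \<open>u\<close>.\<close>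

lemma eq_zero_if_zero_on_corner:
  fixes u :: "'a::cstar_algebra"
  assumes g: "bounded_linear g" and zero: "\<And>w. g (u * w * u) = 0"
  shows "g u = 0"
proof -
  obtain K where K: "0 < K" "\<And>x. norm (g x) \<le> norm x * K"
    using bounded_linear.pos_bounded[OF g] by blast
  have "norm (g u) \<le> \<epsilon>" if \<epsilon>: "0 < \<epsilon>" for \<epsilon>
  proof -
    obtain w where w: "norm (u - u * w * u) < \<epsilon> / K"
      using approximately_regular[of "\<epsilon> / K" u] \<epsilon> K(1) by auto
    have "g u = g (u - u * w * u)"
      by (simp add: zero linear_diff[OF bounded_linear.linear[OF g]])
    then have "norm (g u) \<le> norm (u - u * w * u) * K" using K(2)[of "u - u * w * u"] by simp
    also have "\<dots> \<le> \<epsilon>" using w K(1) by (simp add: field_simps)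
    finally show ?thesis .
  qed
  then have "norm (g u) \<le> 0" by (rule dense_ge)
  then show ?thesis by simp
qed

lemmas module_simps = bidual_mult_distrib bidual_mult_assoc to_bidual_mult to_bidual_add
  to_bidual_diff to_bidual_minus to_bidual_zero commutator_def

text \<open>The situation of \<open>d a = T a - \<eta> \<odot> a\<close> for an anti-derivable \<open>T\<close>. If \<open>\<eta>\<close> were 0, then \<open>d\<close> would be an
  anti-derivation; it turns out to be a derivation in all cases.\<close>

locale twisted_antiderivation =
  fixes d :: "'a::cstar_algebra \<Rightarrow> 'a bidual" and \<eta> :: "'a bidual"
  assumes bounded: "bounded_linear d"
    and star: "d (a\<^sup>\<star>) = (d a)\<^sup>\<bullet>"
    and twisted: "d (c * b) = d b \<odot> \<iota> c + \<iota> b \<odot> d c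
      - \<eta> \<odot> \<iota> (commutator c b) - \<iota> (commutator c b) \<odot> \<eta>\<^sup>\<bullet>"
begin

text \<open>The deviations of \<open>d\<close> from the inner derivations given by \<open>\<eta>\<close> and \<open>- \<eta>\<^sup>*\<close>; they vanish in front of
  and behind commutators.\<close>

definition left_defect :: "'a \<Rightarrow> 'a bidual" where
  "left_defect a = d a + \<eta> \<odot> \<iota> a - \<iota> a \<odot> \<eta>"

definition right_defect :: "'a \<Rightarrow> 'a bidual" where
  "right_defect a = d a + \<iota> a \<odot> \<eta>\<^sup>\<bullet> - \<eta>\<^sup>\<bullet> \<odot> \<iota> a"

lemma left_defect_add: "left_defect (a + b) = left_defect a + left_defect b"
  by (simp add: left_defect_def linear_add[OF bounded_linear.linear[OF bounded]] module_simps)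

lemma star_left_defect: "(left_defect a)\<^sup>\<bullet> = right_defect (a\<^sup>\<star>)"
  by (simp add: left_defect_def right_defect_def star bidual_star_simps
      bidual_star_mult_to_bidual bidual_star_to_bidual_mult)

text \<open>The identity compares the two ways to expand \<open>d (x c b)\<close>.\<close>

lemma left_defect_commutator:
  "left_defect b \<odot> \<iota> (commutator x c) = \<iota> (commutator c b) \<odot> right_defect x"
proof -
  have "left_defect b \<odot> \<iota> (commutator x c) - \<iota> (commutator c b) \<odot> right_defect x
    = (d b \<odot> \<iota> (x * c) + \<iota> b \<odot> (d c \<odot> \<iota> x + \<iota> c \<odot> d x
          - \<eta> \<odot> \<iota> (commutator x c) - \<iota> (commutator x c) \<odot> \<eta>\<^sup>\<bullet>)
        - \<eta> \<odot> \<iota> (commutator (x * c) b) - \<iota> (commutator (x * c) b) \<odot> \<eta>\<^sup>\<bullet>)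
      - ((d b \<odot> \<iota> c + \<iota> b \<odot> d c - \<eta> \<odot> \<iota> (commutator c b) - \<iota> (commutator c b) \<odot> \<eta>\<^sup>\<bullet>) \<odot> \<iota> x
        + \<iota> (c * b) \<odot> d x - \<eta> \<odot> \<iota> (commutator x (c * b)) - \<iota> (commutator x (c * b)) \<odot> \<eta>\<^sup>\<bullet>)"
    by (simp add: left_defect_def right_defect_def module_simps algebra_simps)
  also have "\<dots> = d ((x * c) * b) - d (x * (c * b))"
    by (simp only: twisted[of "x * c" b] twisted[of x "c * b"] twisted[of x c] twisted[of c b])
  finally show ?thesis by (simp add: mult.assoc)
qed

text \<open>For \<open>c = b\<close> the right side of the previous identity is zero. The factor \<open>y\<close> comes from the Leibniz
  rule \<open>[y x, b] = y [x, b] + [y, b] x\<close>.\<close>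

lemma left_defect_own_commutator: "left_defect b \<odot> \<iota> (y * commutator x b) = 0"
proof -
  have comm: "left_defect b \<odot> \<iota> (commutator z b) = 0" for z
    using left_defect_commutator[of b z b] by (simp add: module_simps)
  have "y * commutator x b = commutator (y * x) b - commutator y b * x"
    by (simp add: commutator_def algebra_simps)
  then have "left_defect b \<odot> \<iota> (y * commutator x b)
    = left_defect b \<odot> \<iota> (commutator (y * x) b) - (left_defect b \<odot> \<iota> (commutator y b)) \<odot> \<iota> x"
    by (simp only: to_bidual_diff to_bidual_mult bidual_mult_distrib bidual_mult_assoc)
  then show ?thesis by (simp add: comm bidual_mult_distrib)
qed

text \<open>Polarization of the previous lemma in \<open>b\<close>.\<close>

lemma left_defect_swap:
  "left_defect a \<odot> \<iota> (y * commutator x b) = - (left_defect b \<odot> \<iota> (y * commutator x a))"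
proof -
  have "y * commutator x (a + b) = y * commutator x a + y * commutator x b"
    by (simp add: commutator_def algebra_simps)
  then have "left_defect (a + b) \<odot> \<iota> (y * commutator x (a + b))
    = left_defect a \<odot> \<iota> (y * commutator x a) + left_defect a \<odot> \<iota> (y * commutator x b)
      + (left_defect b \<odot> \<iota> (y * commutator x a) + left_defect b \<odot> \<iota> (y * commutator x b))"
    by (simp only: left_defect_add to_bidual_add bidual_mult_distrib ac_simps)
  then show ?thesis
    by (simp add: left_defect_own_commutator eq_neg_iff_add_eq_0)
qed

text \<open>Let \<open>u = [x, b]\<close>. In \<open>left_defect a \<odot> y u w u\<close> the swap moves \<open>b\<close> from the last factor into the
  defect, which then annihilates the first \<open>u\<close>.\<close>

lemma left_defect_mult_commutator: "left_defect a \<odot> \<iota> (y * commutator x b) = 0"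
proof (rule eq_zero_if_zero_on_corner[where g = "\<lambda>z. left_defect a \<odot> \<iota> (y * z)"])
  show "bounded_linear (\<lambda>z. left_defect a \<odot> \<iota> (y * z))"
    by (rule bounded_linear_compose[OF bounded_linear_mult_to_bidual bounded_linear_mult_right])
  fix w
  have "left_defect a \<odot> \<iota> ((y * commutator x b * w) * commutator x b)
    = - ((left_defect b \<odot> \<iota> (y * commutator x b)) \<odot> \<iota> (w * commutator x a))"
    unfolding left_defect_swap[of a _ x b]
    by (simp only: to_bidual_mult bidual_mult_assoc)
  then show "left_defect a \<odot> \<iota> (y * (commutator x b * w * commutator x b)) = 0"
    by (simp add: left_defect_own_commutator bidual_mult_distrib mult.assoc)
qed

lemma left_defect_any_commutator: "left_defect a \<odot> \<iota> (commutator x b) = 0"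
  by (rule eq_zero_if_zero_on_corner[OF bounded_linear_mult_to_bidual])
    (simp add: left_defect_mult_commutator mult.assoc[symmetric])

lemma right_defect_any_commutator: "\<iota> (commutator x b) \<odot> right_defect a = 0"
proof -
  have "commutator x b = (commutator (b\<^sup>\<star>) (x\<^sup>\<star>))\<^sup>\<star>"
    by (simp add: commutator_def star_diff star_mult star_star)
  then have "\<iota> (commutator x b) \<odot> right_defect a
    = (left_defect (a\<^sup>\<star>) \<odot> \<iota> (commutator (b\<^sup>\<star>) (x\<^sup>\<star>)))\<^sup>\<bullet>"
    by (simp add: bidual_star_mult_to_bidual star_left_defect star_star)
  then show ?thesis by (simp add: left_defect_any_commutator bidual_star_simps)
qed

text \<open>In front of \<open>[x, y]\<close> all values of \<open>d\<close> in the twisted rule are those of the inner derivation of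
  \<open>\<eta>\<close>. Since that map satisfies the Leibniz rule, only terms with \<open>[b, c]\<close> remain.\<close>

lemma commutator_twist_commutator:
  "\<iota> (commutator b c) \<odot> (\<eta> + \<eta>\<^sup>\<bullet>) \<odot> \<iota> (commutator x y) = 0"
proof -
  let ?v = "\<iota> (commutator x y)"
  have v: "left_defect a \<odot> ?v = 0" "left_defect a \<odot> (\<iota> z \<odot> ?v) = 0" for a z
    using left_defect_mult_commutator[of a z x y]
    by (simp_all add: left_defect_any_commutator to_bidual_mult)
  have "0 = (d b \<odot> \<iota> c + \<iota> b \<odot> d c - d (c * b) - \<eta> \<odot> \<iota> (commutator c b)
      - \<iota> (commutator c b) \<odot> \<eta>\<^sup>\<bullet>) \<odot> ?v"
    by (simp add: twisted bidual_mult_distrib)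
  also have "\<dots> = left_defect b \<odot> (\<iota> c \<odot> ?v) + \<iota> b \<odot> (left_defect c \<odot> ?v) - left_defect (c * b) \<odot> ?v
      + \<iota> (commutator b c) \<odot> (\<eta> + \<eta>\<^sup>\<bullet>) \<odot> ?v"
    unfolding left_defect_def commutator_def[of c b] commutator_def[of b c]
    by (simp add: bidual_mult_distrib bidual_mult_assoc to_bidual_mult to_bidual_diff algebra_simps)
  finally show ?thesis by (simp add: v bidual_mult_distrib)
qed

text \<open>The left side of the commutator condition.\<close>

definition twist :: "'a \<Rightarrow> 'a bidual" where
  "twist a = d a + \<iota> a \<odot> \<eta>\<^sup>\<bullet> + \<eta> \<odot> \<iota> a"

lemma twist_mult:
  assumes "left_defect b \<odot> \<iota> c = 0" "\<iota> b \<odot> right_defect c = 0"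
  shows "twist (c * b) = \<iota> b \<odot> (\<eta> + \<eta>\<^sup>\<bullet>) \<odot> \<iota> c"
proof -
  have "twist (c * b) = left_defect b \<odot> \<iota> c + \<iota> b \<odot> right_defect c + \<iota> b \<odot> (\<eta> + \<eta>\<^sup>\<bullet>) \<odot> \<iota> c"
    unfolding twist_def left_defect_def right_defect_def twisted
    by (simp add: module_simps algebra_simps)
  then show ?thesis by (simp add: assms)
qed

theorem twist_commutator: "twist (commutator x y) = 0"
proof (rule eq_zero_if_zero_on_corner)
  show "bounded_linear twist"
    unfolding twist_def[abs_def]
    by (intro bounded_linear_add bounded bounded_linear_mult_to_bidual bounded_linear_to_bidual_mult)
  fix w
  let ?u = "commutator x y"
  have "twist ((?u * w) * ?u) = \<iota> ?u \<odot> (\<eta> + \<eta>\<^sup>\<bullet>) \<odot> \<iota> (?u * w)"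
  proof (rule twist_mult)
    have "left_defect ?u \<odot> \<iota> (?u * w) = (left_defect ?u \<odot> \<iota> ?u) \<odot> \<iota> w"
      by (simp add: to_bidual_mult bidual_mult_assoc)
    then show "left_defect ?u \<odot> \<iota> (?u * w) = 0"
      by (simp add: left_defect_any_commutator bidual_mult_distrib)
  qed (rule right_defect_any_commutator)
  also have "\<dots> = (\<iota> ?u \<odot> (\<eta> + \<eta>\<^sup>\<bullet>) \<odot> \<iota> ?u) \<odot> \<iota> w"
    by (simp add: to_bidual_mult bidual_mult_assoc)
  also have "\<dots> = 0"
    unfolding commutator_twist_commutator by (simp add: bidual_mult_distrib)
  finally show "twist (?u * w * ?u) = 0" .
qed

corollary derivation: "d (a * b) = d a \<odot> \<iota> b + \<iota> a \<odot> d b"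
proof -
  have "d (a * b) - d (b * a) = d (commutator a b)"
    by (simp add: commutator_def linear_diff[OF bounded_linear.linear[OF bounded]])
  also have "\<dots> = - (\<iota> (commutator a b) \<odot> \<eta>\<^sup>\<bullet>) - \<eta> \<odot> \<iota> (commutator a b)"
    using twist_commutator[of a b] by (simp add: twist_def algebra_simps eq_neg_iff_add_eq_0)
  finally show ?thesis
    unfolding twisted[of b a] by (simp add: module_simps algebra_simps)
qed

end

section \<open>The equivalence\<close>

text \<open>Write \<open>S c = (T (c\<^sup>*))\<^sup>*\<close>. The balanced identity reads
  \<open>T b \<odot> c y + b \<odot> S (c y) = T (y b) \<odot> c + y b \<odot> S c\<close>. The limit in \<open>b\<close> gives a formula for \<open>S (c y)\<close>;
  the further limit in \<open>c\<close> gives \<open>S y = T y - \<eta> \<odot> y + y \<odot> \<eta>\<^sup>*\<close>. Substituting the second into the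
  first leaves the twisted rule.\<close>

lemma twisted_antiderivation_if_anti_derivable:
  fixes T :: "'a::cstar_algebra \<Rightarrow> 'a bidual"
  assumes T: "bounded_clinear T" and anti: "l_star_anti_derivable_at_zero T"
  shows "\<exists>\<eta>. twisted_antiderivation (\<lambda>a. T a - \<eta> \<odot> \<iota> a) \<eta>"
proof -
  have T_add: "T (x + y) = T x + T y" and T_scale: "T (c *\<^sub>C x) = c *\<^sub>C T x" for x y c
    using T by (simp_all add: bounded_clinear_def clinear_iff)
  have T_bl: "bounded_linear T" using T by (simp add: bounded_clinear_iff)
  obtain K where K: "0 < K" "\<And>x. norm (T x) \<le> norm x * K"
    using bounded_linear.pos_bounded[OF T_bl] by blast
  define B where "B a b = T b \<odot> \<iota> (a\<^sup>\<star>) + \<iota> b \<odot> (T a)\<^sup>\<bullet>" for a b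
  have B_left: "B (a + a') b = B a b + B a' b" "B (c *\<^sub>C a) b = cnj c *\<^sub>C B a b" for a a' b c
    by (simp_all add: B_def T_add T_scale star_add star_scaleC to_bidual_add to_bidual_scaleC
        bidual_mult_distrib bidual_star_simps scaleC_add_right)
  have B_right: "B a (b + b') = B a b + B a b'" "B a (c *\<^sub>C b) = c *\<^sub>C B a b" for a b b' c
    by (simp_all add: B_def T_add T_scale to_bidual_add to_bidual_scaleC
        bidual_mult_distrib scaleC_add_right)
  have "norm (B a b) \<le> norm a * norm b * (2 * K)" for a b
  proof -
    have "norm (T b \<odot> \<iota> (a\<^sup>\<star>)) \<le> (norm b * K) * norm a"
      by (intro order_trans[OF norm_bidual_mult] mult_mono K)
        (use norm_to_bidual_le[of "a\<^sup>\<star>"] K(1) in \<open>auto simp: norm_star\<close>)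
    moreover have "norm (\<iota> b \<odot> (T a)\<^sup>\<bullet>) \<le> norm b * (norm a * K)"
      by (intro order_trans[OF norm_bidual_mult] mult_mono norm_to_bidual_le
          order_trans[OF norm_bidual_star_le] K) auto
    ultimately show ?thesis
      unfolding B_def by (intro order_trans[OF norm_triangle_ineq]) (simp add: algebra_simps)
  qed
  then have "bounded_bilinear B"
    by (intro bounded_bilinear.intro) (auto simp: B_left B_right scaleR_scaleC)
  moreover have "B a b = 0" if "a\<^sup>\<star> * b = 0" for a b
    using anti that by (simp add: B_def l_star_anti_derivable_at_zero_def)
  ultimately have balanced: "B (c * a) b = B a (c\<^sup>\<star> * b)" for a b c
    by (rule orthogonal_form_balanced) (simp_all add: B_left B_right)
  define S where "S c = (T (c\<^sup>\<star>))\<^sup>\<bullet>" for c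
  have S: "T b \<odot> \<iota> (c * y) + \<iota> b \<odot> S (c * y) = T (y * b) \<odot> \<iota> c + \<iota> (y * b) \<odot> S c" for b c y
    using balanced[of "y\<^sup>\<star>" "c\<^sup>\<star>" b] by (simp add: B_def S_def star_mult star_star)
  obtain F :: "'a filter" where "approximate_unit F"
    using approximate_unit_exists by blast
  then interpret approximate_unit F .
  obtain \<eta> where \<eta>: "\<And>f. ((\<lambda>e. apply_dual (T e) f) \<longlongrightarrow> apply_dual \<eta> f) F"
    using weak_star_limit[OF T] by blast
  have T_cont: "((\<lambda>e. apply_dual (T (g e)) f) \<longlongrightarrow> apply_dual (T x) f) F"
    if "(g \<longlongrightarrow> x) F" for g x f
    using bounded_linear.tendsto[OF bounded_linear_compose[OF apply_dual_bounded_linear[of "\<iota> f"] T_bl] that]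
    by simp
  have \<eta>1: "\<eta> \<odot> \<iota> (c * y) + S (c * y) = T y \<odot> \<iota> c + \<iota> y \<odot> S c" for c y
  proof (rule cdual_eqI)
    fix f
    have "((\<lambda>e. apply_dual (T e \<odot> \<iota> (c * y) + \<iota> e \<odot> S (c * y)) f)
      \<longlongrightarrow> apply_dual (\<eta> \<odot> \<iota> (c * y) + S (c * y)) f) F"
      unfolding apply_dual_plus
      by (intro tendsto_add tendsto_left_bidual) (unfold apply_bidual_mult, rule \<eta>)
    moreover have "((\<lambda>e. apply_dual (T (y * e) \<odot> \<iota> c + \<iota> (y * e) \<odot> S c) f)
      \<longlongrightarrow> apply_dual (T y \<odot> \<iota> c + \<iota> y \<odot> S c) f) F"
      unfolding apply_dual_plus apply_bidual_mult apply_to_bidual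
      by (intro tendsto_add T_cont tendsto_right bounded_linear.tendsto[OF apply_dual_bounded_linear])
    ultimately show "apply_dual (\<eta> \<odot> \<iota> (c * y) + S (c * y)) f
      = apply_dual (T y \<odot> \<iota> c + \<iota> y \<odot> S c) f"
      unfolding S by (rule tendsto_unique[OF proper])
  qed
  have \<eta>2: "\<eta> \<odot> \<iota> y + S y = T y + \<iota> y \<odot> \<eta>\<^sup>\<bullet>" for y
  proof (rule cdual_eqI)
    fix f
    have "((\<lambda>e. apply_dual (\<iota> f) (\<eta> \<odot> \<iota> (e * y))) \<longlongrightarrow> apply_dual (\<iota> f) (\<eta> \<odot> \<iota> y)) F"
      by (intro bounded_linear.tendsto[OF apply_dual_bounded_linear]
          bounded_linear.tendsto[OF bounded_linear_mult_to_bidual] tendsto_left)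
    moreover have "((\<lambda>e. apply_dual (S (e * y)) f) \<longlongrightarrow> apply_dual (S y) f) F"
      unfolding S_def apply_bidual_star by (intro tendsto_cnj T_cont tendsto_star tendsto_left)
    ultimately have "((\<lambda>e. apply_dual (\<eta> \<odot> \<iota> (e * y) + S (e * y)) f)
      \<longlongrightarrow> apply_dual (\<eta> \<odot> \<iota> y + S y) f) F"
      unfolding apply_dual_plus apply_to_bidual by (rule tendsto_add)
    moreover have "((\<lambda>e. apply_dual (T y \<odot> \<iota> e + \<iota> y \<odot> S e) f)
      \<longlongrightarrow> apply_dual (T y + \<iota> y \<odot> \<eta>\<^sup>\<bullet>) f) F"
      unfolding apply_dual_plus
    proof (intro tendsto_add tendsto_right_bidual)
      have "((\<lambda>e. cnj (apply_dual (T e \<odot> \<iota> (y\<^sup>\<star>)) (dual_star f)))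
        \<longlongrightarrow> cnj (apply_dual (\<eta> \<odot> \<iota> (y\<^sup>\<star>)) (dual_star f))) F"
        unfolding apply_bidual_mult by (intro tendsto_cnj \<eta>)
      then have "((\<lambda>e. apply_dual (\<iota> y \<odot> (T e)\<^sup>\<bullet>) f) \<longlongrightarrow> apply_dual (\<iota> y \<odot> \<eta>\<^sup>\<bullet>) f) F"
        by (simp add: bidual_star_mult_to_bidual star_star flip: apply_bidual_star)
      moreover have "\<forall>\<^sub>F e in F. apply_dual (\<iota> y \<odot> (T e)\<^sup>\<bullet>) f = apply_dual (\<iota> y \<odot> S e) f"
        using self_adjoint by eventually_elim (simp add: S_def)
      ultimately show "((\<lambda>e. apply_dual (\<iota> y \<odot> S e) f) \<longlongrightarrow> apply_dual (\<iota> y \<odot> \<eta>\<^sup>\<bullet>) f) F"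
        by (simp add: tendsto_cong)
    qed
    ultimately show "apply_dual (\<eta> \<odot> \<iota> y + S y) f = apply_dual (T y + \<iota> y \<odot> \<eta>\<^sup>\<bullet>) f"
      unfolding \<eta>1 by (rule tendsto_unique[OF proper])
  qed
  have S_eq: "S y = T y - \<eta> \<odot> \<iota> y + \<iota> y \<odot> \<eta>\<^sup>\<bullet>" for y
    using \<eta>2[of y] by (simp add: algebra_simps)
  have "twisted_antiderivation (\<lambda>a. T a - \<eta> \<odot> \<iota> a) \<eta>"
  proof (rule twisted_antiderivation.intro)
    show "bounded_linear (\<lambda>a. T a - \<eta> \<odot> \<iota> a)"
      by (intro bounded_linear_sub T_bl bounded_linear_mult_to_bidual)
    fix a b c
    have "(T a)\<^sup>\<bullet> = S (a\<^sup>\<star>)" by (simp add: S_def star_star)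
    then show "T (a\<^sup>\<star>) - \<eta> \<odot> \<iota> (a\<^sup>\<star>) = (T a - \<eta> \<odot> \<iota> a)\<^sup>\<bullet>"
      by (simp add: S_eq bidual_star_simps bidual_star_mult_to_bidual)
    have "T (c * b) = T b \<odot> \<iota> c + \<iota> b \<odot> S c - \<iota> (c * b) \<odot> \<eta>\<^sup>\<bullet>"
      using \<eta>1[of c b] unfolding S_eq by (simp add: algebra_simps)
    then show "T (c * b) - \<eta> \<odot> \<iota> (c * b) = (T b - \<eta> \<odot> \<iota> b) \<odot> \<iota> c + \<iota> b \<odot> (T c - \<eta> \<odot> \<iota> c)
        - \<eta> \<odot> \<iota> (commutator c b) - \<iota> (commutator c b) \<odot> \<eta>\<^sup>\<bullet>"
      unfolding S_eq by (simp add: module_simps algebra_simps)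
  qed
  then show ?thesis by blast
qed

theorem corollary12:
  fixes T :: "'a::cstar_algebra \<Rightarrow> 'a bidual"
  assumes "bounded_clinear T"
  shows "l_star_anti_derivable_at_zero T \<longleftrightarrow>
    (\<exists>(d :: 'a \<Rightarrow> 'a bidual) (\<eta> :: 'a bidual). star_derivation d \<and>
       (\<forall>a b. d (commutator a b) + \<iota> (commutator a b) \<odot> \<eta>\<^sup>\<bullet> + \<eta> \<odot> \<iota> (commutator a b) = 0) \<and>
       (\<forall>a b. T (a * b) = \<iota> a \<odot> T b + T a \<odot> \<iota> b - \<iota> a \<odot> \<eta> \<odot> \<iota> b) \<and>
       (\<forall>a. T a = d a + \<eta> \<odot> \<iota> a))"
proof
  assume "l_star_anti_derivable_at_zero T"
  then obtain \<eta> where "twisted_antiderivation (\<lambda>a. T a - \<eta> \<odot> \<iota> a) \<eta>"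
    using twisted_antiderivation_if_anti_derivable[OF assms] by blast
  then interpret twisted_antiderivation "\<lambda>a. T a - \<eta> \<odot> \<iota> a" \<eta> .
  have "clinear (\<lambda>a. T a - \<eta> \<odot> \<iota> a)"
    using assms by (simp add: bounded_clinear_def clinear_iff to_bidual_add to_bidual_scaleC
        bidual_mult_distrib scaleC_diff_right)
  then have "star_derivation (\<lambda>a. T a - \<eta> \<odot> \<iota> a)"
    by (simp add: star_derivation_def derivation star)
  moreover have "T (a * b) = \<iota> a \<odot> T b + T a \<odot> \<iota> b - \<iota> a \<odot> \<eta> \<odot> \<iota> b" for a b
    using derivation[of a b] by (simp add: module_simps algebra_simps)
  ultimately show "\<exists>d \<eta>. star_derivation d \<and>
      (\<forall>a b. d (commutator a b) + \<iota> (commutator a b) \<odot> \<eta>\<^sup>\<bullet> + \<eta> \<odot> \<iota> (commutator a b) = 0) \<and>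
      (\<forall>a b. T (a * b) = \<iota> a \<odot> T b + T a \<odot> \<iota> b - \<iota> a \<odot> \<eta> \<odot> \<iota> b) \<and>
      (\<forall>a. T a = d a + \<eta> \<odot> \<iota> a)"
    using twist_commutator
    by (intro exI[of _ "\<lambda>a. T a - \<eta> \<odot> \<iota> a"] exI[of _ \<eta>]) (simp add: twist_def)
next
  assume "\<exists>d \<eta>. star_derivation d \<and>
      (\<forall>a b. d (commutator a b) + \<iota> (commutator a b) \<odot> \<eta>\<^sup>\<bullet> + \<eta> \<odot> \<iota> (commutator a b) = 0) \<and>
      (\<forall>a b. T (a * b) = \<iota> a \<odot> T b + T a \<odot> \<iota> b - \<iota> a \<odot> \<eta> \<odot> \<iota> b) \<and>
      (\<forall>a. T a = d a + \<eta> \<odot> \<iota> a)"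
  then obtain d \<eta> where d: "star_derivation d"
    and comm: "\<And>a b. d (commutator a b) + \<iota> (commutator a b) \<odot> \<eta>\<^sup>\<bullet> + \<eta> \<odot> \<iota> (commutator a b) = 0"
    and T: "\<And>a. T a = d a + \<eta> \<odot> \<iota> a"
    by blast
  have "T b \<odot> \<iota> (a\<^sup>\<star>) + \<iota> b \<odot> (T a)\<^sup>\<bullet> = 0" if "a\<^sup>\<star> * b = 0" for a b
  proof -
    have "T b \<odot> \<iota> (a\<^sup>\<star>) + \<iota> b \<odot> (T a)\<^sup>\<bullet>
      = d (b * a\<^sup>\<star>) + \<iota> (b * a\<^sup>\<star>) \<odot> \<eta>\<^sup>\<bullet> + \<eta> \<odot> \<iota> (b * a\<^sup>\<star>)"
      using d by (simp add: T star_derivation_def bidual_star_simps bidual_star_mult_to_bidual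
          bidual_mult_distrib bidual_mult_assoc to_bidual_mult algebra_simps)
    then show ?thesis
      using comm[of b "a\<^sup>\<star>"] that by (simp add: commutator_def)
  qed
  then show "l_star_anti_derivable_at_zero T"
    by (simp add: l_star_anti_derivable_at_zero_def)
qed

end
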